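(* Let $k\in\mathbb{N}$. There is a constant $C_k>0$ depending only on $k$ such that for every $n\in\mathbb{N}$ and every family $\mathcal{A}\subset\mathcal{P}[n]$ of subsets of $[n]=\{1,\ldots,n\}$ with $|A\setminus B|\neq k$ for all $A,B\in\mathcal{A}$, we have \[ |\mathcal{A}| \le \frac{C_k}{n^k}\binom{n}{\lfloor n/2\rfloor}. \]
   Context: $\mathcal{P}[n]$ denotes the power set of $[n]=\{1,\ldots,n\}$. *)

theory Defs
  imports Complex_Main
begin

end

theory Submission
  imports Defs "HOL-Library.Ramsey" "HOL-Combinatorics.Permutations"
begin

text \<open>
  Let \<open>k \<ge> 1\<close>. The core is a bound for codes: for a suitable \<open>s = s(k)\<close>, a code in \<open>[q]\<^sup>s\<close> without two
  words at Hamming distance exactly \<open>k\<close> has \<open>O(q\<^bsup>s-k\<^esup>)\<close> words. Call a coordinate set \<open>I\<close> rich for a word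
  \<open>f\<close> if many code words differ from \<open>f\<close> exactly on \<open>I\<close>. All but \<open>O(q\<^bsup>s-k\<^esup>)\<close> words have a nonempty rich
  subset in every \<open>k\<close>-set of coordinates. Ramsey's theorem then gives a \<open>k\<close>-set \<open>K\<close> that is a union of
  rich sets, and walking along these leads from a word to another one differing from it exactly on \<open>K\<close>.

  The code bound is carried over to set families by averaging over permutations of a template: sets
  \<open>C\<^sub>i \<union> T\<close> with \<open>C\<^sub>i\<close> from a chain and \<open>T\<close> a transversal of \<open>s\<close> blocks of size \<open>q \<approx> n / (2s)\<close>. For
  \<open>i \<le> j\<close> the difference of \<open>C\<^sub>i \<union> T\<close> and \<open>C\<^sub>j \<union> T'\<close> has as many elements as the Hamming distance of \<open>T\<close>
  and \<open>T'\<close>, so the transversals that occur form a code, whatever their levels. One transversal could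
  still occur at several levels, but given a member \<open>A\<close>, the single-level bound applied to the sets
  above \<open>A\<close> shows that such coincidences have density \<open>O(n\<^bsup>-k\<^esup>)\<close> per level, which is negligible once the
  levels are restricted to a residue class modulo a large constant. Sets of size above \<open>n / 2\<close> are
  treated by complementation.
\<close>

section \<open>Codes without a given Hamming distance\<close>

text \<open>Finite Ramsey for \<open>d\<close>-sets, coloured by membership in \<open>\<J>\<close>
  and carried along a bijection from \<open>{..<N}\<close>. The vertex set is arbitrary because the
  induction in \<open>ramsey_cover\<close> passes to subsets.\<close>

lemma ramsey_two_colours:
  "\<exists>N. \<forall>(Y :: nat set) (\<J> :: nat set set). finite Y \<longrightarrow> card Y = N \<longrightarrow>
     (\<exists>K\<in>nsets Y a. nsets K d \<subseteq> \<J>) \<or> (\<exists>Z\<in>nsets Y b. nsets Z d \<inter> \<J> = {})"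
proof -
  obtain N :: nat where N: "partn_lst {..<N} [a,b] d" using ramsey_full by blast
  show ?thesis
  proof (intro exI[of _ N] allI impI)
    fix Y :: "nat set" and \<J> :: "nat set set"
    assume Y: "finite Y" "card Y = N"
    then obtain h where h: "bij_betw h {..<N} Y"
      by (metis bij_betw_iff_card card_lessThan finite_lessThan)
    define f where "f I = (if h ` I \<in> \<J> then 0 else 1::nat)" for I
    have "f \<in> nsets {..<N} d \<rightarrow> {..<length [a,b]}" by (auto simp: f_def)
    then obtain i H where i: "i < length [a,b]" "H \<in> nsets {..<N} ([a,b] ! i)"
        "f ` nsets H d \<subseteq> {i}"
      using N unfolding partn_lst_def monochromatic_def by blast
    have hH: "bij_betw h H (h ` H)"
      using h i(2) by (auto simp: nsets_def bij_betw_def intro: inj_on_subset)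
    have HY: "h ` H \<in> nsets Y ([a,b] ! i)"
      using bij_betw_nsets[OF h] i(2) by (auto simp: bij_betw_def)
    have img: "nsets (h ` H) d = (\<lambda>X. h ` X) ` nsets H d"
      using bij_betw_nsets[OF hH] by (auto simp: bij_betw_def)
    consider "i = 0" | "i = 1" using i(1) by fastforce
    then show "(\<exists>K\<in>nsets Y a. nsets K d \<subseteq> \<J>) \<or> (\<exists>Z\<in>nsets Y b. nsets Z d \<inter> \<J> = {})"
    proof cases
      case 1
      then have "nsets (h ` H) d \<subseteq> \<J>" using i(3) unfolding img f_def by (auto split: if_splits)
      then show ?thesis using HY 1 by auto
    next
      case 2
      then have "nsets (h ` H) d \<inter> \<J> = {}" using i(3) unfolding img f_def by (auto split: if_splits)
      then show ?thesis using HY 2 by auto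
    qed
  qed
qed

lemma nsets_union_cover:
  assumes "finite K" "x \<in> K" "1 \<le> d" "d \<le> card K"
  shows "\<exists>I\<in>nsets K d. x \<in> I"
proof -
  have "d - 1 \<le> card (K - {x})" using assms by simp
  then obtain I where "I \<subseteq> K - {x}" "card I = d - 1" "finite I"
    by (meson obtain_subset_with_card_n)
  then show ?thesis using assms
    by (intro bexI[of _ "insert x I"]) (auto simp: nsets_def card_insert_if)
qed

text \<open>Apply Ramsey's theorem to one subset size after another. If no size \<open>d\<close>
  gave a \<open>k\<close>-set with all its \<open>d\<close>-subsets in \<open>\<J>\<close>, the
  nested subsets would end in a \<open>k\<close>-set containing no nonempty member of
  \<open>\<J>\<close>, against the hypothesis. The \<open>d\<close>-subsets of the
  \<open>k\<close>-set found cover it. The number \<open>s\<close> depends on \<open>k\<close>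
  alone, not on \<open>\<J>\<close>.\<close>

lemma ramsey_cover:
  assumes k: "1 \<le> k"
  shows "\<exists>s. \<forall>\<J> :: nat set set.
     (\<forall>K\<in>nsets {..<s} k. \<exists>I\<in>\<J>. I \<noteq> {} \<and> I \<subseteq> K) \<longrightarrow>
     (\<exists>K\<in>nsets {..<s} k. \<forall>x\<in>K. \<exists>I\<in>\<J>. x \<in> I \<and> I \<subseteq> K)"
proof -
  have step: "\<exists>N. \<forall>(Y :: nat set) (\<J> :: nat set set). finite Y \<longrightarrow> card Y = N \<longrightarrow>
     (\<exists>d\<in>{1..D}. \<exists>K\<in>nsets Y k. nsets K d \<subseteq> \<J>) \<or>
     (\<exists>Z\<in>nsets Y k. \<forall>d\<in>{1..D}. nsets Z d \<inter> \<J> = {})" for D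
  proof (induction D)
    case 0
    show ?case by (rule exI[of _ k]) (auto simp: nsets_def)
  next
    case (Suc D)
    then obtain m where m: "\<And>(Y :: nat set) (\<J> :: nat set set). finite Y \<Longrightarrow> card Y = m \<Longrightarrow>
     (\<exists>d\<in>{1..D}. \<exists>K\<in>nsets Y k. nsets K d \<subseteq> \<J>) \<or>
     (\<exists>Z\<in>nsets Y k. \<forall>d\<in>{1..D}. nsets Z d \<inter> \<J> = {})" by blast
    \<comment> \<open>The second alternative asks for \<open>m\<close> points, so that the induction
      hypothesis still applies inside \<open>Z\<close>; having no \<open>Suc D\<close>-subset in
      \<open>\<J>\<close> is inherited by every subset of \<open>Z\<close>.\<close>
    obtain N where N: "\<And>(Y :: nat set) (\<J> :: nat set set). finite Y \<Longrightarrow> card Y = N \<Longrightarrow>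
     (\<exists>K\<in>nsets Y k. nsets K (Suc D) \<subseteq> \<J>) \<or> (\<exists>Z\<in>nsets Y m. nsets Z (Suc D) \<inter> \<J> = {})"
      using ramsey_two_colours by blast
    show ?case
    proof (intro exI[of _ N] allI impI)
      fix Y :: "nat set" and \<J> :: "nat set set"
      assume Y: "finite Y" "card Y = N"
      from N[OF Y, of \<J>] show "(\<exists>d\<in>{1..Suc D}. \<exists>K\<in>nsets Y k. nsets K d \<subseteq> \<J>) \<or>
         (\<exists>Z\<in>nsets Y k. \<forall>d\<in>{1..Suc D}. nsets Z d \<inter> \<J> = {})"
      proof
        assume "\<exists>K\<in>nsets Y k. nsets K (Suc D) \<subseteq> \<J>"
        then show ?thesis by force
      next
        assume "\<exists>Z\<in>nsets Y m. nsets Z (Suc D) \<inter> \<J> = {}"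
        then obtain Z where Z: "Z \<subseteq> Y" "finite Z" "card Z = m" "nsets Z (Suc D) \<inter> \<J> = {}"
          by (auto simp: nsets_def)
        from m[OF Z(2,3), of \<J>] show ?thesis
        proof
          assume "\<exists>d\<in>{1..D}. \<exists>K\<in>nsets Z k. nsets K d \<subseteq> \<J>"
          then obtain d K where "d \<in> {1..Suc D}" "K \<in> nsets Y k" "nsets K d \<subseteq> \<J>"
            using nsets_mono[OF Z(1), of k] by fastforce
          then show ?thesis by blast
        next
          assume "\<exists>W\<in>nsets Z k. \<forall>d\<in>{1..D}. nsets W d \<inter> \<J> = {}"
          then obtain W where W: "W \<in> nsets Z k" "\<forall>d\<in>{1..D}. nsets W d \<inter> \<J> = {}" by blast
          have "W \<subseteq> Z" using W(1) by (simp add: nsets_def)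
          then have "nsets W (Suc D) \<inter> \<J> = {}"
            using Z(4) nsets_mono[of W Z "Suc D"] by blast
          then have "\<forall>d\<in>{1..Suc D}. nsets W d \<inter> \<J> = {}" using W(2)
            by (metis atLeastAtMost_iff le_Suc_eq)
          then show ?thesis using W(1) nsets_mono[OF Z(1), of k] by blast
        qed
      qed
    qed
  qed
  obtain s where s: "\<And>(Y :: nat set) (\<J> :: nat set set). finite Y \<Longrightarrow> card Y = s \<Longrightarrow>
     (\<exists>d\<in>{1..k}. \<exists>K\<in>nsets Y k. nsets K d \<subseteq> \<J>) \<or>
     (\<exists>Z\<in>nsets Y k. \<forall>d\<in>{1..k}. nsets Z d \<inter> \<J> = {})" using step[of k] by blast
  show ?thesis
  proof (intro exI[of _ s] allI impI)
    fix \<J> :: "nat set set"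
    assume cov: "\<forall>K\<in>nsets {..<s} k. \<exists>I\<in>\<J>. I \<noteq> {} \<and> I \<subseteq> K"
    have "\<not> (\<exists>Z\<in>nsets {..<s} k. \<forall>d\<in>{1..k}. nsets Z d \<inter> \<J> = {})"
    proof
      assume "\<exists>Z\<in>nsets {..<s} k. \<forall>d\<in>{1..k}. nsets Z d \<inter> \<J> = {}"
      then obtain Z where Z: "Z \<in> nsets {..<s} k" "\<forall>d\<in>{1..k}. nsets Z d \<inter> \<J> = {}" by blast
      with cov obtain I where I: "I \<in> \<J>" "I \<noteq> {}" "I \<subseteq> Z" by blast
      have fin: "finite Z" "card Z = k" using Z(1) by (auto simp: nsets_def)
      then have "card I \<in> {1..k}" "I \<in> nsets Z (card I)" using I
        by (auto simp: nsets_def Suc_le_eq card_gt_0_iff intro: finite_subset card_mono)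
      then show False using Z(2) I(1) by blast
    qed
    with s[OF finite_lessThan card_lessThan, of \<J>]
    obtain d K where dK: "d \<in> {1..k}" "K \<in> nsets {..<s} k" "nsets K d \<subseteq> \<J>"
      by blast
    have "\<exists>I\<in>\<J>. x \<in> I \<and> I \<subseteq> K" if "x \<in> K" for x
      using nsets_union_cover[of K x d] dK that by (auto simp: nsets_def)
    then show "\<exists>K\<in>nsets {..<s} k. \<forall>x\<in>K. \<exists>I\<in>\<J>. x \<in> I \<and> I \<subseteq> K" using dK by blast
  qed
qed

section \<open>Rich coordinate sets and walks in a code\<close>

definition diff_set :: "nat \<Rightarrow> (nat \<Rightarrow> nat) \<Rightarrow> (nat \<Rightarrow> nat) \<Rightarrow> nat set" where
  "diff_set s f g = {i. i < s \<and> f i \<noteq> g i}"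

text \<open>Membership of \<open>I\<close> is a sunflower condition: the words of \<open>F\<close> that differ from \<open>f\<close> exactly on
  \<open>I\<close> cannot be blocked by a single word \<open>g\<close>. This is what makes consecutive steps add up: taking
  \<open>g\<close> to be the start of a walk, a step along \<open>I\<close> never undoes an earlier difference.\<close>

definition rich_sets :: "nat \<Rightarrow> (nat \<Rightarrow> nat) set \<Rightarrow> (nat \<Rightarrow> nat) \<Rightarrow> nat set set" where
  "rich_sets s F f = {I. I \<subseteq> {..<s} \<and>
     (\<forall>g. \<exists>h\<in>F. diff_set s f h = I \<and> (\<forall>i\<in>I. h i \<noteq> g i))}"

abbreviation words :: "nat \<Rightarrow> nat \<Rightarrow> (nat \<Rightarrow> nat) set" where
  "words s q \<equiv> Pi\<^sub>E {..<s} (\<lambda>_. {..<q})"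

text \<open>This is the hypothesis of \<open>ramsey_cover\<close>. The empty set has to be excluded:
  it is rich for every word of the code, as the word itself is a witness.\<close>

definition covers :: "nat \<Rightarrow> nat \<Rightarrow> nat set set \<Rightarrow> bool" where
  "covers s k \<J> \<longleftrightarrow> (\<forall>K\<in>nsets {..<s} k. \<exists>I\<in>\<J>. I \<noteq> {} \<and> I \<subseteq> K)"

lemma rich_sets_mono: "F \<subseteq> G \<Longrightarrow> rich_sets s F f \<subseteq> rich_sets s G f"
  unfolding rich_sets_def by blast

text \<open>As \<open>K\<close> is not rich for \<open>f\<close>, some \<open>g\<close> blocks it:
  each word of \<open>G\<close> agrees on some coordinate of \<open>K\<close> with \<open>f\<close>
  or with \<open>g\<close>. This splits \<open>G\<close> into at most \<open>2 * m\<close> parts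
  with one more coordinate fixed, whence the recursion behind \<open>2 ^ m * fact m\<close>.
  Richness refers to the fixed family \<open>F\<close>, so it is unaffected when \<open>G\<close>
  shrinks.\<close>

lemma card_poor_fibre:
  assumes "finite G" "G \<subseteq> F" "G \<subseteq> extensional {..<s}" "K \<subseteq> {..<s}" "card K = m"
    and "\<And>f h i. f \<in> G \<Longrightarrow> h \<in> G \<Longrightarrow> i < s \<Longrightarrow> i \<notin> K \<Longrightarrow> f i = h i"
    and "\<And>f I. f \<in> G \<Longrightarrow> I \<subseteq> K \<Longrightarrow> I \<noteq> {} \<Longrightarrow> I \<notin> rich_sets s F f"
  shows "card G \<le> 2 ^ m * fact m"
  using assms
proof (induction m arbitrary: K G)
  case 0
  then have K: "K = {}" by (simp add: finite_subset[OF "0.prems"(4)])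
  have "f = h" if "f \<in> G" "h \<in> G" for f h
  proof (rule extensionalityI[of _ "{..<s}"])
    show "f \<in> extensional {..<s}" "h \<in> extensional {..<s}" using that "0.prems"(3) by auto
    show "f i = h i" if "i \<in> {..<s}" for i using "0.prems"(6) \<open>f \<in> G\<close> \<open>h \<in> G\<close> that K by simp
  qed
  then have "card G \<le> 1" by (metis One_nat_def card_le_Suc0_iff_eq "0.prems"(1))
  then show ?case by simp
next
  case (Suc m)
  have finK: "finite K" using Suc.prems(4) finite_subset by blast
  show ?case
  proof (cases "G = {}")
    case False
    then obtain f where f: "f \<in> G" by blast
    have "K \<noteq> {}" using Suc.prems(5) by auto
    then have "K \<notin> rich_sets s F f" using Suc.prems(7)[OF f, of K] by blast
    then obtain g where g: "\<And>h. h \<in> F \<Longrightarrow> diff_set s f h = K \<Longrightarrow> \<exists>i\<in>K. h i = g i"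
      using Suc.prems(4) unfolding rich_sets_def by blast
    define A where "A i a = {h\<in>G. h i = a}" for i a
    have sub: "G \<subseteq> (\<Union>i\<in>K. A i (f i) \<union> A i (g i))"
    proof
      fix h assume h: "h \<in> G"
      have "diff_set s f h \<subseteq> K" using Suc.prems(6)[OF f h] by (auto simp: diff_set_def)
      then show "h \<in> (\<Union>i\<in>K. A i (f i) \<union> A i (g i))"
      proof (cases "diff_set s f h = K")
        case True
        then show ?thesis using g[of h] h Suc.prems(2) by (auto simp: A_def)
      next
        case False
        with \<open>diff_set s f h \<subseteq> K\<close> obtain i where "i \<in> K" "i \<notin> diff_set s f h" by blast
        then have "h i = f i" using Suc.prems(4) by (auto simp: diff_set_def)
        then show ?thesis using \<open>i \<in> K\<close> h by (auto simp: A_def)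
      qed
    qed
    have cA: "card (A i a) \<le> 2 ^ m * fact m" if i: "i \<in> K" for i a
    proof (rule Suc.IH[of _ "K - {i}"])
      show "card (K - {i}) = m" using i Suc.prems(5) finK by simp
      show "f' j = h j" if "f' \<in> A i a" "h \<in> A i a" "j < s" "j \<notin> K - {i}" for f' h j
        using that Suc.prems(6)[of f' h j] by (auto simp: A_def)
      show "I \<notin> rich_sets s F f'" if "f' \<in> A i a" "I \<subseteq> K - {i}" "I \<noteq> {}" for f' I
        using that Suc.prems(7)[of f' I] by (auto simp: A_def)
    qed (use Suc.prems in \<open>auto simp: A_def\<close>)
    have "card G \<le> card (\<Union>i\<in>K. A i (f i) \<union> A i (g i))"
      using sub finK Suc.prems(1) by (intro card_mono) (auto simp: A_def)
    also have "\<dots> \<le> (\<Sum>i\<in>K. card (A i (f i) \<union> A i (g i)))" by (rule card_UN_le[OF finK])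
    also have "\<dots> \<le> (\<Sum>i\<in>K. 2 * (2 ^ m * fact m))"
    proof (rule sum_mono)
      fix i assume "i \<in> K"
      then show "card (A i (f i) \<union> A i (g i)) \<le> 2 * (2 ^ m * fact m)"
        using card_Un_le[of "A i (f i)" "A i (g i)"] cA[of i "f i"] cA[of i "g i"] by linarith
    qed
    also have "\<dots> = 2 ^ Suc m * fact (Suc m)" using Suc.prems(5) by (simp add: algebra_simps)
    finally show ?thesis .
  qed simp
qed

text \<open>Group the words by their restriction to the coordinates outside \<open>K\<close>: there
  are \<open>q ^ (s - k)\<close> restrictions, and \<open>card_poor_fibre\<close> bounds each
  group.\<close>

lemma card_poor:
  assumes F: "F \<subseteq> words s q" and K: "K \<in> nsets {..<s} k"
  shows "card {f\<in>F. \<forall>I\<in>rich_sets s F f. I \<subseteq> K \<longrightarrow> I = {}} \<le> q ^ (s - k) * (2 ^ k * fact k)"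
proof -
  define P where "P = {f\<in>F. \<forall>I\<in>rich_sets s F f. I \<subseteq> K \<longrightarrow> I = {}}"
  define R where "R = Pi\<^sub>E ({..<s} - K) (\<lambda>_. {..<q})"
  define A where "A r = {f\<in>P. restrict f ({..<s} - K) = r}" for r
  have finF: "finite F" using F finite_PiE[of "{..<s}" "\<lambda>_. {..<q}"] finite_subset by blast
  have Ks: "K \<subseteq> {..<s}" "card K = k" "finite K" using K by (auto simp: nsets_def)
  have cR: "card R = q ^ (s - k)"
    using Ks by (simp add: R_def card_PiE card_Diff_subset)
  have finR: "finite R" unfolding R_def by (intro finite_PiE) auto
  have sub: "P \<subseteq> (\<Union>r\<in>R. A r)"
  proof
    fix f assume f: "f \<in> P"
    then have "f \<in> words s q" using F by (auto simp: P_def)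
    then have "restrict f ({..<s} - K) \<in> R" unfolding R_def by (auto simp: PiE_iff)
    then show "f \<in> (\<Union>r\<in>R. A r)" using f by (auto simp: A_def)
  qed
  have cA: "card (A r) \<le> 2 ^ k * fact k" for r
  proof (rule card_poor_fibre[where F = F and s = s and K = K])
    show "finite (A r)" "A r \<subseteq> F" using finF by (auto simp: A_def P_def)
    show "A r \<subseteq> extensional {..<s}" using F by (auto simp: A_def P_def PiE_def)
    show "f i = h i" if "f \<in> A r" "h \<in> A r" "i < s" "i \<notin> K" for f h i
    proof -
      have "restrict f ({..<s} - K) i = restrict h ({..<s} - K) i" using that by (simp add: A_def)
      then show ?thesis using that by simp
    qed
  qed (use Ks in \<open>auto simp: A_def P_def\<close>)
  have "card P \<le> card (\<Union>r\<in>R. A r)"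
    using sub finR finF by (intro card_mono) (auto simp: A_def P_def)
  also have "\<dots> \<le> (\<Sum>r\<in>R. card (A r))" by (rule card_UN_le[OF finR])
  also have "\<dots> \<le> (\<Sum>r\<in>R. 2 ^ k * fact k)" by (intro sum_mono cA)
  also have "\<dots> = q ^ (s - k) * (2 ^ k * fact k)" by (simp add: cR)
  finally show ?thesis unfolding P_def .
qed

lemma card_not_covering:
  assumes F: "F \<subseteq> words s q"
  shows "card {f\<in>F. \<not> covers s k (rich_sets s F f)} \<le> (s choose k) * (2 ^ k * fact k) * q ^ (s - k)"
proof -
  have finF: "finite F" using F finite_PiE[of "{..<s}" "\<lambda>_. {..<q}"] finite_subset by blast
  define P where "P K = {f\<in>F. \<forall>I\<in>rich_sets s F f. I \<subseteq> K \<longrightarrow> I = {}}" for K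
  have fin: "finite (nsets {..<s} k)" by (simp add: finite_imp_finite_nsets)
  have "card {f\<in>F. \<not> covers s k (rich_sets s F f)} \<le> card (\<Union>K\<in>nsets {..<s} k. P K)"
    using finF fin by (intro card_mono) (auto simp: P_def covers_def)
  also have "\<dots> \<le> (\<Sum>K\<in>nsets {..<s} k. card (P K))" by (rule card_UN_le[OF fin])
  also have "\<dots> \<le> (\<Sum>K\<in>nsets {..<s} k. q ^ (s - k) * (2 ^ k * fact k))"
    unfolding P_def by (intro sum_mono card_poor F)
  also have "\<dots> = (s choose k) * (2 ^ k * fact k) * q ^ (s - k)" by simp
  finally show ?thesis .
qed

text \<open>Each step of the walk may leave the current subfamily, but the enclosing family is chosen so that
  all words of the subfamily have the same rich sets in it. As rich sets only grow with the family, the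
  sets \<open>\<J>\<close> obtained for the innermost subfamily are available at every step.\<close>

lemma large_code_walks:
  "\<exists>C::nat. \<forall>q F. F \<subseteq> words s q \<longrightarrow> card F > C * q ^ (s - k) \<longrightarrow>
     (\<exists>f\<in>F. \<exists>\<J>\<subseteq>rich_sets s F f. covers s k \<J> \<and>
        (\<forall>Is. set Is \<subseteq> \<J> \<longrightarrow> length Is = t \<longrightarrow> (\<exists>h\<in>F. diff_set s f h = \<Union>(set Is))))"
proof (induction t)
  case 0
  define c where "c = (s choose k) * (2 ^ k * fact k)"
  show ?case
  proof (intro exI[of _ c] allI impI)
    fix q F assume F: "F \<subseteq> words s q" "card F > c * q ^ (s - k)"
    have "{f\<in>F. \<not> covers s k (rich_sets s F f)} \<noteq> F"
      using card_not_covering[OF F(1), of k] F(2) unfolding c_def by auto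
    then obtain f where f: "f \<in> F" "covers s k (rich_sets s F f)" by blast
    have "diff_set s f f = {}" by (simp add: diff_set_def)
    with f show "\<exists>f\<in>F. \<exists>\<J>\<subseteq>rich_sets s F f. covers s k \<J> \<and>
        (\<forall>Is. set Is \<subseteq> \<J> \<longrightarrow> length Is = 0 \<longrightarrow> (\<exists>h\<in>F. diff_set s f h = \<Union>(set Is)))"
      by (intro bexI[of _ f] exI[of _ "rich_sets s F f"]) auto
  qed
next
  case (Suc t)
  define c where "c = (s choose k) * (2 ^ k * fact k)"
  from Suc obtain C :: nat where C: "\<And>q F. F \<subseteq> words s q \<Longrightarrow> card F > C * q ^ (s - k) \<Longrightarrow>
     (\<exists>f\<in>F. \<exists>\<J>\<subseteq>rich_sets s F f. covers s k \<J> \<and>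
        (\<forall>Is. set Is \<subseteq> \<J> \<longrightarrow> length Is = t \<longrightarrow> (\<exists>h\<in>F. diff_set s f h = \<Union>(set Is))))"
    by blast
  define T where "T = Pow (Pow {..<s})"
  have T: "finite T" "card T = 2 ^ 2 ^ s" by (auto simp: T_def card_Pow)
  show ?case
  \<comment> \<open>The summand \<open>c\<close> pays for the words whose rich sets do not cover.
    The remaining words fall into \<open>2 ^ 2 ^ s\<close> classes according to their family of rich
    sets, so one class is large enough for the induction hypothesis.\<close>
  proof (intro exI[of _ "c + 2 ^ 2 ^ s * C"] allI impI)
    fix q F assume F: "F \<subseteq> words s q" "card F > (c + 2 ^ 2 ^ s * C) * q ^ (s - k)"
    have finF: "finite F" using F finite_PiE[of "{..<s}" "\<lambda>_. {..<q}"] finite_subset by blast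
    define cls where "cls \<J> = {f\<in>F. rich_sets s F f = \<J>}" for \<J>
    define G where "G = {f\<in>F. covers s k (rich_sets s F f)}"
    have "card F = card G + card {f\<in>F. \<not> covers s k (rich_sets s F f)}"
      unfolding G_def using finF by (subst card_Un_disjoint[symmetric]) (auto intro: arg_cong[where f=card])
    then have G: "card G > 2 ^ 2 ^ s * (C * q ^ (s - k))"
      using card_not_covering[OF F(1), of k] F(2) unfolding c_def by (simp add: algebra_simps)
    have "\<exists>\<J>\<in>T. card (G \<inter> cls \<J>) > C * q ^ (s - k)"
    proof (rule ccontr)
      assume "\<not> ?thesis"
      then have le: "\<And>\<J>. \<J> \<in> T \<Longrightarrow> card (G \<inter> cls \<J>) \<le> C * q ^ (s - k)" by force
      have "card G \<le> card (\<Union>\<J>\<in>T. G \<inter> cls \<J>)"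
        using finF T(1) by (intro card_mono) (auto simp: G_def cls_def T_def rich_sets_def)
      also have "\<dots> \<le> (\<Sum>\<J>\<in>T. card (G \<inter> cls \<J>))" by (rule card_UN_le[OF T(1)])
      also have "\<dots> \<le> (\<Sum>\<J>\<in>T. C * q ^ (s - k))" by (intro sum_mono le)
      also have "\<dots> = 2 ^ 2 ^ s * (C * q ^ (s - k))" by (simp add: T(2))
      finally show False using G by simp
    qed
    then obtain \<J>0 where J0: "card (G \<inter> cls \<J>0) > C * q ^ (s - k)" by blast
    define F1 where "F1 = G \<inter> cls \<J>0"
    have F1: "F1 \<subseteq> F" by (auto simp: F1_def G_def)
    have rich: "rich_sets s F h = \<J>0" if "h \<in> F1" for h
      using that by (auto simp: F1_def cls_def)
    have "F1 \<subseteq> words s q" "card F1 > C * q ^ (s - k)" using F1 F(1) J0 by (auto simp: F1_def)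
    from C[OF this] obtain f \<J> where f: "f \<in> F1" "\<J> \<subseteq> rich_sets s F1 f" "covers s k \<J>"
      and walk: "\<And>Is. set Is \<subseteq> \<J> \<Longrightarrow> length Is = t \<Longrightarrow> \<exists>h\<in>F1. diff_set s f h = \<Union>(set Is)" by blast
    have sub: "\<J> \<subseteq> rich_sets s F f" using f(2) rich_sets_mono[OF F1] by blast
    have "\<exists>h\<in>F. diff_set s f h = \<Union>(set Is)" if Is: "set Is \<subseteq> \<J>" "length Is = Suc t" for Is
    proof -
      obtain I Is' where Is': "Is = I # Is'" using Is(2) by (cases Is) auto
      then obtain h where h: "h \<in> F1" "diff_set s f h = \<Union>(set Is')"
        using walk[of Is'] Is by auto
      have "I \<in> rich_sets s F h" using Is' Is(1) sub rich[OF h(1)] rich[OF f(1)] by auto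
      then obtain h' where h': "h' \<in> F" "diff_set s h h' = I" "\<And>i. i \<in> I \<Longrightarrow> h' i \<noteq> f i"
        and Is: "I \<subseteq> {..<s}"
        unfolding rich_sets_def by blast
      have "diff_set s f h' = I \<union> diff_set s f h"
      proof (intro set_eqI)
        fix i
        have "i \<in> I \<longleftrightarrow> i < s \<and> h i \<noteq> h' i" using h'(2) by (auto simp: diff_set_def)
        then show "i \<in> diff_set s f h' \<longleftrightarrow> i \<in> I \<union> diff_set s f h"
          using h'(3)[of i] Is by (cases "i \<in> I") (auto simp: diff_set_def)
      qed
      then show ?thesis using h'(1) h(2) Is' by auto
    qed
    moreover have "f \<in> F" using f F1 by blast
    ultimately show "\<exists>f\<in>F. \<exists>\<J>\<subseteq>rich_sets s F f. covers s k \<J> \<and>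
        (\<forall>Is. set Is \<subseteq> \<J> \<longrightarrow> length Is = Suc t \<longrightarrow> (\<exists>h\<in>F. diff_set s f h = \<Union>(set Is)))"
      using f(3) sub by (intro bexI[of _ f] exI[of _ \<J>]) auto
  qed
qed

text \<open>In a larger code some word has steps \<open>\<J>\<close> covering the
  \<open>k\<close>-sets, so by the choice of \<open>s\<close> some \<open>k\<close>-set
  \<open>K\<close> is a union of steps. Choosing one step for each point of \<open>K\<close>, with
  repetitions allowed, gives a walk of length \<open>k\<close> that ends at Hamming distance
  \<open>k\<close>.\<close>

proposition code_bound:
  assumes k: "1 \<le> k"
  obtains s C :: nat where "k \<le> s" "1 \<le> C"
    "\<And>q F. F \<subseteq> words s q \<Longrightarrow> (\<And>f g. f \<in> F \<Longrightarrow> g \<in> F \<Longrightarrow> card (diff_set s f g) \<noteq> k) \<Longrightarrow>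
       card F * q ^ k \<le> C * q ^ s"
proof -
  obtain s where s: "\<And>\<J>. covers s k \<J> \<Longrightarrow>
       \<exists>K\<in>nsets {..<s} k. \<forall>x\<in>K. \<exists>I\<in>\<J>. x \<in> I \<and> I \<subseteq> K"
    using ramsey_cover[OF k] unfolding covers_def by blast
  \<comment> \<open>The property of \<open>s\<close> is applied to the family of all sets merely to
    see that \<open>{..<s}\<close> has a \<open>k\<close>-subset, that is,
    \<open>k \<le> s\<close>.\<close>
  have "K \<noteq> {}" if "K \<in> nsets {..<s} k" for K using that k by (auto simp: nsets_def)
  then have "covers s k UNIV" unfolding covers_def by blast
  from s[OF this] have "nsets {..<s} k \<noteq> {}" by blast
  then have ks: "k \<le> s" by (simp add: nsets_eq_empty_iff)
  obtain C :: nat where C: "\<And>q F. F \<subseteq> words s q \<Longrightarrow> card F > C * q ^ (s - k) \<Longrightarrow>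
     (\<exists>f\<in>F. \<exists>\<J>\<subseteq>rich_sets s F f. covers s k \<J> \<and>
        (\<forall>Is. set Is \<subseteq> \<J> \<longrightarrow> length Is = k \<longrightarrow> (\<exists>h\<in>F. diff_set s f h = \<Union>(set Is))))"
    using large_code_walks[of s k k] by blast
  have main: "card F * q ^ k \<le> Suc C * q ^ s"
    if F: "F \<subseteq> words s q" and no: "\<And>f g. f \<in> F \<Longrightarrow> g \<in> F \<Longrightarrow> card (diff_set s f g) \<noteq> k" for q F
  proof -
    have "\<not> card F > C * q ^ (s - k)"
    proof
      assume "card F > C * q ^ (s - k)"
      from C[OF F this] obtain f \<J> where f: "f \<in> F" "covers s k \<J>"
        and walk: "\<And>Is. set Is \<subseteq> \<J> \<Longrightarrow> length Is = k \<Longrightarrow> \<exists>h\<in>F. diff_set s f h = \<Union>(set Is)"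
        by blast
      from s[OF f(2)] obtain K where K: "K \<in> nsets {..<s} k" "\<forall>x\<in>K. \<exists>I\<in>\<J>. x \<in> I \<and> I \<subseteq> K" by blast
      then obtain pick where pick: "\<And>x. x \<in> K \<Longrightarrow> pick x \<in> \<J> \<and> x \<in> pick x \<and> pick x \<subseteq> K" by metis
      have finK: "finite K" "card K = k" using K by (auto simp: nsets_def)
      obtain xs where xs: "set xs = K" "length xs = k"
        using finK finite_distinct_list distinct_card by metis
      have "\<exists>h\<in>F. diff_set s f h = \<Union>(set (map pick xs))"
        using pick xs by (intro walk) auto
      moreover have "\<Union>(set (map pick xs)) = K" using pick xs by auto
      ultimately show False using no f(1) finK(2) by metis
    qed
    then have "card F * q ^ k \<le> C * q ^ (s - k) * q ^ k" by (intro mult_right_mono) simp_all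
    also have "\<dots> = C * q ^ s" using ks by (simp add: power_add[symmetric])
    finally show ?thesis by simp
  qed
  show ?thesis by (rule that[OF ks _ main]) simp_all
qed

section \<open>Averaging over permutations\<close>

lemma ex_permutes_image_pair:
  assumes X: "finite X" and A: "A \<subseteq> X" "A' \<subseteq> X" "card A = card A'"
    and R: "R \<subseteq> X - A" "R' \<subseteq> X - A'" "card R = card R'"
  shows "\<exists>\<tau>. \<tau> permutes X \<and> \<tau> ` A = A' \<and> \<tau> ` R = R'"
proof -
  have fin: "finite A" "finite A'" "finite R" "finite R'"
    using assms by (meson finite_subset finite_Diff)+
  have c: "card (X - A - R) = card (X - A' - R')"
    using assms fin by (simp add: card_Diff_subset)
  obtain h1 where h1: "bij_betw h1 A A'" using A(3) fin by (metis bij_betw_iff_card)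
  obtain h2 where h2: "bij_betw h2 R R'" using R(3) fin by (metis bij_betw_iff_card)
  obtain h3 where h3: "bij_betw h3 (X - A - R) (X - A' - R')"
    using c X by (metis bij_betw_iff_card finite_Diff)
  define \<tau> where "\<tau> x = (if x \<in> A then h1 x else if x \<in> R then h2 x else if x \<in> X then h3 x else x)" for x
  have b1: "bij_betw \<tau> A A'" using h1 by (rule bij_betw_cong[THEN iffD1, rotated]) (simp add: \<tau>_def)
  have b2: "bij_betw \<tau> R R'"
    using h2 by (rule bij_betw_cong[THEN iffD1, rotated]) (use R in \<open>auto simp: \<tau>_def\<close>)
  have b3: "bij_betw \<tau> (X - A - R) (X - A' - R')"
    using h3 by (rule bij_betw_cong[THEN iffD1, rotated]) (auto simp: \<tau>_def)
  have "bij_betw \<tau> (A \<union> R) (A' \<union> R')" using b1 b2 by (rule bij_betw_combine) (use R in auto)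
  then have "bij_betw \<tau> ((A \<union> R) \<union> (X - A - R)) ((A' \<union> R') \<union> (X - A' - R'))"
    using b3 by (rule bij_betw_combine) auto
  moreover have "(A \<union> R) \<union> (X - A - R) = X" "(A' \<union> R') \<union> (X - A' - R') = X" using A R by auto
  ultimately have "\<tau> permutes X" by (intro bij_imp_permutes) (use A R in \<open>auto simp: \<tau>_def\<close>)
  then show ?thesis using b1 b2 by (auto simp: bij_betw_def)
qed

text \<open>The image pair of a uniformly random permutation is uniform on pairs of disjoint sets of
  the given sizes: composing with a permutation that takes one pair to another injects one fibre
  into the other, so all fibres have equal size.\<close>

lemma card_permutes_image_pair:
  assumes X: "finite X" and P: "P \<subseteq> X" and Q: "Q \<subseteq> X - P"
    and \<S>: "\<S> \<subseteq> Sigma (nsets X (card P)) (\<lambda>A. nsets (X - A) (card Q))"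
  shows "real (card {\<sigma>. \<sigma> permutes X \<and> (\<sigma> ` P, \<sigma> ` Q) \<in> \<S>}) =
    fact (card X) * real (card \<S>) /
      (real (card X choose card P) * real ((card X - card P) choose card Q))"
proof -
  define S where "S = Sigma (nsets X (card P)) (\<lambda>A. nsets (X - A) (card Q))"
  define fib where "fib z = {\<sigma>. \<sigma> permutes X \<and> (\<sigma> ` P, \<sigma> ` Q) = z}" for z
  have finperm: "finite {\<sigma>. \<sigma> permutes X}" using X by (rule finite_permutations)
  have finfib: "finite (fib z)" for z
    by (rule finite_subset[OF _ finperm]) (auto simp: fib_def)
  have finS: "finite S"
    unfolding S_def using X by (auto simp: finite_imp_finite_nsets)
  have cardS: "card S = (card X choose card P) * ((card X - card P) choose card Q)"
  proof -
    have "card S = (\<Sum>A\<in>nsets X (card P). card (nsets (X - A) (card Q)))"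
      unfolding S_def using X by (subst card_SigmaI) (auto simp: finite_imp_finite_nsets)
    also have "\<dots> = (\<Sum>A\<in>nsets X (card P). (card X - card P) choose card Q)"
    proof (rule sum.cong[OF refl])
      fix A assume "A \<in> nsets X (card P)"
      then have "card (X - A) = card X - card P" by (simp add: nsets_def card_Diff_subset)
      then show "card (nsets (X - A) (card Q)) = (card X - card P) choose card Q" by simp
    qed
    finally show ?thesis by simp
  qed
  have le: "card (fib z) \<le> card (fib w)" if z: "z \<in> S" and w: "w \<in> S" for z w
  proof -
    obtain A R where zz: "z = (A, R)" by (cases z)
    obtain A' R' where ww: "w = (A', R')" by (cases w)
    obtain \<tau> where \<tau>: "\<tau> permutes X" "\<tau> ` A = A'" "\<tau> ` R = R'"
      using ex_permutes_image_pair[OF X, of A A' R R'] z w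
      unfolding S_def zz ww by (auto simp: nsets_def)
    have "inj \<tau>" using \<tau>(1) by (rule permutes_inj)
    then have "inj_on ((\<circ>) \<tau>) (fib z)" by (auto simp: inj_on_def fun_eq_iff)
    moreover have "(\<circ>) \<tau> ` fib z \<subseteq> fib w"
      using \<tau> unfolding fib_def zz ww by (auto simp: permutes_compose image_comp[symmetric])
    ultimately show ?thesis using finfib by (metis card_inj_on_le)
  qed
  have in_S: "(\<sigma> ` P, \<sigma> ` Q) \<in> S" if "\<sigma> permutes X" for \<sigma>
  proof -
    have i: "inj \<sigma>" "\<sigma> ` X = X" using that by (auto simp: permutes_inj permutes_image)
    have "\<sigma> ` P \<subseteq> X" using P i(2) by blast
    moreover have "\<sigma> ` Q \<subseteq> X" using Q i(2) by blast
    moreover have "\<sigma> ` Q \<inter> \<sigma> ` P = {}" using Q by (simp add: image_Int[OF i(1), symmetric]) blast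
    ultimately have "\<sigma> ` P \<subseteq> X" "\<sigma> ` Q \<subseteq> X - \<sigma> ` P" by blast+
    moreover have "finite P" "finite Q" using P Q X by (meson finite_subset finite_Diff)+
    ultimately show ?thesis
      using i by (auto simp: S_def nsets_def card_image inj_on_subset[OF _ subset_UNIV])
  qed
  have part: "card {\<sigma>. \<sigma> permutes X \<and> (\<sigma> ` P, \<sigma> ` Q) \<in> \<T>} = (\<Sum>z\<in>\<T>. card (fib z))"
    if "\<T> \<subseteq> S" for \<T>
  proof -
    have "finite \<T>" using that finS finite_subset by blast
    have "{\<sigma>. \<sigma> permutes X \<and> (\<sigma> ` P, \<sigma> ` Q) \<in> \<T>} = (\<Union>z\<in>\<T>. fib z)" by (auto simp: fib_def)
    also have "card \<dots> = (\<Sum>z\<in>\<T>. card (fib z))"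
      by (rule card_UN_disjoint) (use \<open>finite \<T>\<close> finfib in \<open>auto simp: fib_def\<close>)
    finally show ?thesis .
  qed
  define z0 where "z0 = (P, Q)"
  have z0: "z0 \<in> S" using in_S[OF permutes_id] by (simp add: z0_def)
  have eq: "card (fib z) = card (fib z0)" if "z \<in> S" for z
    using le[OF that z0] le[OF z0 that] by simp
  have "fact (card X) = card {\<sigma>. \<sigma> permutes X}" using X by (simp add: card_permutations)
  also have "{\<sigma>. \<sigma> permutes X} = {\<sigma>. \<sigma> permutes X \<and> (\<sigma> ` P, \<sigma> ` Q) \<in> S}" using in_S by auto
  also have "card \<dots> = card S * card (fib z0)" using part[of S] eq by simp
  finally have tot: "fact (card X) = card S * card (fib z0)" .
  have Spos: "card S > 0" using z0 finS by (auto simp: card_gt_0_iff)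
  have "card {\<sigma>. \<sigma> permutes X \<and> (\<sigma> ` P, \<sigma> ` Q) \<in> \<S>} = card \<S> * card (fib z0)"
  proof -
    have "(\<Sum>z\<in>\<S>. card (fib z)) = (\<Sum>z\<in>\<S>. card (fib z0))"
      by (rule sum.cong) (use eq \<S> in \<open>auto simp: S_def\<close>)
    then show ?thesis using part[of \<S>] \<S> by (simp add: S_def)
  qed
  moreover have "fact (card X) = real (card S) * real (card (fib z0))"
    using tot by (metis of_nat_fact of_nat_mult)
  ultimately have "real (card {\<sigma>. \<sigma> permutes X \<and> (\<sigma> ` P, \<sigma> ` Q) \<in> \<S>}) =
     fact (card X) * real (card \<S>) / real (card S)"
    using Spos by simp
  then show ?thesis by (simp add: cardS)
qed

lemma card_permutes_image:
  assumes X: "finite X" and P: "P \<subseteq> X" and \<D>: "\<D> \<subseteq> nsets X (card P)"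
  shows "real (card {\<sigma>. \<sigma> permutes X \<and> \<sigma> ` P \<in> \<D>}) =
    fact (card X) * real (card \<D>) / real (card X choose card P)"
proof -
  have "{\<sigma>. \<sigma> permutes X \<and> \<sigma> ` P \<in> \<D>} =
      {\<sigma>. \<sigma> permutes X \<and> (\<sigma> ` P, \<sigma> ` {}) \<in> \<D> \<times> {{}}}" by auto
  moreover have "card (\<D> \<times> {{}::'a set}) = card \<D>" by (simp add: card_cartesian_product)
  ultimately show ?thesis
    using card_permutes_image_pair[OF X P, of "{}" "\<D> \<times> {{}}"] \<D> by auto
qed

text \<open>\<open>s\<close> disjoint blocks of size \<open>q\<close> and a chain \<open>C\<close> outside them. A word \<open>f\<close> picks one point of each
  block, and the members are a chain set together with such a transversal.\<close>

locale block_chain =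
  fixes X :: "'a set" and s q :: nat and v :: "nat \<Rightarrow> nat \<Rightarrow> 'a" and C :: "nat \<Rightarrow> 'a set"
  assumes finX: "finite X"
    and v_in: "\<And>i a. i < s \<Longrightarrow> a < q \<Longrightarrow> v i a \<in> X"
    and v_inj: "\<And>i a j b. i < s \<Longrightarrow> a < q \<Longrightarrow> j < s \<Longrightarrow> b < q \<Longrightarrow> v i a = v j b \<Longrightarrow> i = j \<and> a = b"
    and C_sub: "\<And>j. j + s * q \<le> card X \<Longrightarrow> C j \<subseteq> X"
    and C_card: "\<And>j. j + s * q \<le> card X \<Longrightarrow> card (C j) = j"
    and C_disj: "\<And>j i a. j + s * q \<le> card X \<Longrightarrow> i < s \<Longrightarrow> a < q \<Longrightarrow> v i a \<notin> C j"
    and C_mono: "\<And>i j. i \<le> j \<Longrightarrow> C i \<subseteq> C j"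

lemma ex_block_chain:
  assumes X: "finite X" and le: "s * q \<le> card X"
  obtains v C where "block_chain X s q v C"
proof -
  obtain e where e: "bij_betw e {..<card X} X"
    using X by (metis bij_betw_iff_card card_lessThan finite_lessThan)
  \<comment> \<open>In the enumeration \<open>e\<close>, the first \<open>s * q\<close> points are
    cut into \<open>s\<close> consecutive blocks of length \<open>q\<close>; the later points are
    added to the chain one at a time.\<close>
  define v where "v i a = e (i * q + a)" for i a
  define C where "C j = e ` {s * q..<s * q + j}" for j
  have lt: "i * q + a < s * q" if "i < s" "a < q" for i a
  proof -
    have "i * q + a < Suc i * q" using that by simp
    also have "\<dots> \<le> s * q" using that by (intro mult_right_mono) auto
    finally show ?thesis .
  qed
  have inj: "inj_on e {..<card X}" and img: "e ` {..<card X} = X" using e by (auto simp: bij_betw_def)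
  have "block_chain X s q v C"
  proof
    show "v i a \<in> X" if "i < s" "a < q" for i a
      using lt[OF that] le img by (auto simp: v_def)
    show "i = j \<and> a = b" if "i < s" "a < q" "j < s" "b < q" "v i a = v j b" for i a j b
    proof -
      have "i * q + a = j * q + b"
        using inj_onD[OF inj] that(5) lt[OF that(1,2)] lt[OF that(3,4)] le by (simp add: v_def)
      then have "(i * q + a) div q = (j * q + b) div q" "(i * q + a) mod q = (j * q + b) mod q"
        by simp_all
      then show ?thesis using that by simp
    qed
    show "C j \<subseteq> X" if "j + s * q \<le> card X" for j using that img by (auto simp: C_def)
    show "card (C j) = j" if "j + s * q \<le> card X" for j
    proof -
      have "inj_on e {s * q..<s * q + j}" by (rule inj_on_subset[OF inj]) (use that in auto)
      then show ?thesis by (simp add: C_def card_image)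
    qed
    show "v i a \<notin> C j" if "j + s * q \<le> card X" "i < s" "a < q" for j i a
    proof
      assume "v i a \<in> C j"
      then obtain x where x: "x \<in> {s * q..<s * q + j}" "e (i * q + a) = e x"
        by (auto simp: C_def v_def)
      then have "i * q + a = x" using inj_onD[OF inj, of "i * q + a" x] lt[OF that(2,3)] that(1) by auto
      then show False using x(1) lt[OF that(2,3)] by simp
    qed
    show "C i \<subseteq> C j" if "i \<le> j" for i j unfolding C_def by (rule image_mono) (use that in auto)
  qed (rule X)
  then show ?thesis by (rule that)
qed

context block_chain
begin

text \<open>The index \<open>l\<close> is meant to be the size of the set. The transversal supplies
  \<open>s\<close> points and the chain \<open>l - s\<close>, so this is right only from level
  \<open>s\<close> on.\<close>

definition member :: "nat \<Rightarrow> (nat \<Rightarrow> nat) \<Rightarrow> 'a set" where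
  "member l f = C (l - s) \<union> (\<lambda>i. v i (f i)) ` {..<s}"

lemma word_less: "f \<in> words s q \<Longrightarrow> i < s \<Longrightarrow> f i < q"
  by (auto simp: PiE_iff)

lemma member_subset:
  assumes "f \<in> words s q" "l - s + s * q \<le> card X"
  shows "member l f \<subseteq> X"
  using assms C_sub v_in word_less by (fastforce simp: member_def)

lemma card_member:
  assumes f: "f \<in> words s q" and l: "l - s + s * q \<le> card X" "s \<le> l"
  shows "card (member l f) = l"
proof -
  have fin: "finite (C (l - s))" using C_sub[OF l(1)] finX finite_subset by blast
  have "inj_on (\<lambda>i. v i (f i)) {..<s}"
    using v_inj word_less[OF f] by (auto simp: inj_on_def) blast
  then have "card ((\<lambda>i. v i (f i)) ` {..<s}) = s" by (simp add: card_image)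
  moreover have "C (l - s) \<inter> (\<lambda>i. v i (f i)) ` {..<s} = {}"
    using C_disj[OF l(1)] word_less[OF f] by blast
  ultimately show ?thesis
    unfolding member_def using fin C_card[OF l(1)] l(2) by (simp add: card_Un_disjoint)
qed

text \<open>The larger chain set absorbs the smaller one and meets no block, so exactly the points
  of the first transversal at which the words disagree survive. The direction matters: subtracting
  the higher member from the lower makes the levels disappear from the result.\<close>

lemma card_member_diff:
  assumes \<sigma>: "\<sigma> permutes X" and f: "f \<in> words s q" and g: "g \<in> words s q"
    and l: "l \<le> l'" "l' - s + s * q \<le> card X"
  shows "card (\<sigma> ` member l f - \<sigma> ` member l' g) = card (diff_set s f g)"
proof -
  have l': "l - s + s * q \<le> card X" using l by simp
  have "member l f - member l' g = (\<lambda>i. v i (f i)) ` diff_set s f g"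
  proof
    show "member l f - member l' g \<subseteq> (\<lambda>i. v i (f i)) ` diff_set s f g"
      using C_mono[of "l - s" "l' - s"] l(1) by (force simp: member_def diff_set_def)
    show "(\<lambda>i. v i (f i)) ` diff_set s f g \<subseteq> member l f - member l' g"
    proof
      fix x assume "x \<in> (\<lambda>i. v i (f i)) ` diff_set s f g"
      then obtain i where i: "x = v i (f i)" "i < s" "f i \<noteq> g i" by (auto simp: diff_set_def)
      have "x \<notin> C (l' - s)" using C_disj[OF l(2) i(2)] word_less[OF f i(2)] i(1) by simp
      moreover have "x \<noteq> v j (g j)" if "j < s" for j
        using v_inj[of i "f i" j "g j"] word_less[OF f i(2)] word_less[OF g that] i that by metis
      ultimately show "x \<in> member l f - member l' g" using i by (auto simp: member_def)
    qed
  qed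
  moreover have "inj_on (\<lambda>i. v i (f i)) (diff_set s f g)"
    using v_inj word_less[OF f] by (auto simp: inj_on_def diff_set_def) blast
  moreover have "\<sigma> ` member l f - \<sigma> ` member l' g = \<sigma> ` (member l f - member l' g)"
    using permutes_inj[OF \<sigma>] by (simp add: image_set_diff)
  moreover have "inj_on \<sigma> A" for A using permutes_inj[OF \<sigma>] by (rule inj_on_subset) simp
  ultimately show ?thesis by (simp add: card_image)
qed

end

section \<open>Families on a single level\<close>

text \<open>The conclusion of \<open>code_bound\<close> for fixed constants, named so that the
  averaging lemmas can assume it.\<close>

definition code_const :: "nat \<Rightarrow> nat \<Rightarrow> nat \<Rightarrow> bool" where
  "code_const k s K \<longleftrightarrow> (\<forall>q F. F \<subseteq> words s q \<longrightarrow>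
     (\<forall>f\<in>F. \<forall>g\<in>F. card (diff_set s f g) \<noteq> k) \<longrightarrow> card F * q ^ k \<le> K * q ^ s)"

lemma card_words: "card (words s q) = q ^ s"
  by (simp add: card_PiE)

lemma finite_words: "finite (words s q)"
  by (intro finite_PiE) auto

lemma sum_card_swap:
  assumes "finite A" "finite B"
  shows "(\<Sum>x\<in>A. card {y\<in>B. P x y}) = (\<Sum>y\<in>B. card {x\<in>A. P x y})"
proof -
  have "(\<Sum>x\<in>A. card {y\<in>B. P x y}) = (\<Sum>x\<in>A. \<Sum>y\<in>B. if P x y then 1 else 0)"
    using assms by (simp add: sum.If_cases Int_def)
  also have "\<dots> = (\<Sum>y\<in>B. \<Sum>x\<in>A. if P x y then 1 else 0)" by (rule sum.swap)
  also have "\<dots> = (\<Sum>y\<in>B. card {x\<in>A. P x y})"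
    using assms by (simp add: sum.If_cases Int_def)
  finally show ?thesis .
qed

text \<open>For each permutation, the words whose permuted members lie in \<open>\<D>\<close> form a
  code, of density at most \<open>K / q ^ k\<close>. Each permuted member is uniform on level
  \<open>d\<close>, so the average density of these codes is the density of \<open>\<D>\<close> in
  that level.\<close>

lemma layer_bound:
  assumes code: "code_const k s K" and q: "1 \<le> q" and X: "finite X"
    and d: "s \<le> d" "d - s + s * q \<le> card X" and \<D>: "\<D> \<subseteq> nsets X d"
    and no: "\<And>A B. A \<in> \<D> \<Longrightarrow> B \<in> \<D> \<Longrightarrow> card (A - B) \<noteq> k"
  shows "real (card \<D>) * real q ^ k \<le> real K * real (card X choose d)"
proof -
  have "s * q \<le> card X" using d(2) by linarith
  then obtain v C where "block_chain X s q v C" using ex_block_chain[OF X] by blast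
  then interpret block_chain X s q v C .
  define Per where "Per = {\<sigma>. \<sigma> permutes X}"
  have Per: "finite Per" "card Per = fact (card X)"
    using X by (auto simp: Per_def finite_permutations card_permutations)
  define F where "F \<sigma> = {f\<in>words s q. \<sigma> ` member d f \<in> \<D>}" for \<sigma>
  have "card (F \<sigma>) * q ^ k \<le> K * q ^ s" if "\<sigma> \<in> Per" for \<sigma>
  proof -
    have "card (diff_set s f g) \<noteq> k" if "f \<in> F \<sigma>" "g \<in> F \<sigma>" for f g
      using card_member_diff[of \<sigma> f g d d] no[of "\<sigma> ` member d f" "\<sigma> ` member d g"] that
        \<open>\<sigma> \<in> Per\<close> d(2) by (auto simp: F_def Per_def)
    moreover have "F \<sigma> \<subseteq> words s q" by (auto simp: F_def)
    ultimately show ?thesis using code unfolding code_const_def by meson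
  qed
  then have "(\<Sum>\<sigma>\<in>Per. card (F \<sigma>) * q ^ k) \<le> (\<Sum>\<sigma>\<in>Per. K * q ^ s)" by (rule sum_mono)
  then have "(\<Sum>\<sigma>\<in>Per. card (F \<sigma>)) * q ^ k \<le> fact (card X) * (K * q ^ s)"
    by (simp add: Per sum_distrib_right)
  then have "real ((\<Sum>\<sigma>\<in>Per. card (F \<sigma>)) * q ^ k) \<le> real (fact (card X) * (K * q ^ s))"
    by (simp only: of_nat_le_iff)
  then have up: "real (\<Sum>\<sigma>\<in>Per. card (F \<sigma>)) * real q ^ k \<le> fact (card X) * (real K * real q ^ s)"
    by simp
  have "(\<Sum>\<sigma>\<in>Per. card (F \<sigma>)) = (\<Sum>f\<in>words s q. card {\<sigma>\<in>Per. \<sigma> ` member d f \<in> \<D>})"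
    unfolding F_def by (rule sum_card_swap) (use Per finite_words in auto)
  then have "real (\<Sum>\<sigma>\<in>Per. card (F \<sigma>)) =
      (\<Sum>f\<in>words s q. real (card {\<sigma>. \<sigma> permutes X \<and> \<sigma> ` member d f \<in> \<D>}))"
    by (simp add: Per_def)
  also have "\<dots> = (\<Sum>f\<in>words s q. fact (card X) * real (card \<D>) / real (card X choose d))"
  proof (rule sum.cong[OF refl])
    fix f assume f: "f \<in> words s q"
    show "real (card {\<sigma>. \<sigma> permutes X \<and> \<sigma> ` member d f \<in> \<D>}) =
        fact (card X) * real (card \<D>) / real (card X choose d)"
      using card_permutes_image[OF X member_subset[OF f d(2)]] card_member[OF f d(2,1)] \<D> by simp
  qed
  also have "\<dots> = real q ^ s * (fact (card X) * real (card \<D>) / real (card X choose d))"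
    by (simp add: card_words)
  finally have "real q ^ s * (fact (card X) * real (card \<D>) / real (card X choose d)) * real q ^ k
      \<le> fact (card X) * (real K * real q ^ s)" using up by simp
  then have "(real q ^ s * fact (card X)) * (real (card \<D>) * real q ^ k / real (card X choose d))
      \<le> (real q ^ s * fact (card X)) * real K" by (simp add: algebra_simps)
  then have "real (card \<D>) * real q ^ k / real (card X choose d) \<le> real K"
    using q by (subst (asm) mult_le_cancel_left_pos) auto
  moreover have "d \<le> card X"
  proof -
    have "s \<le> s * q" using q by simp
    then show ?thesis using d by linarith
  qed
  ultimately show ?thesis by (simp add: pos_divide_le_eq zero_less_binomial_iff mult.commute)
qed

section \<open>Families on widely spaced levels\<close>

text \<open>The pairs containing the minimum suffice. With \<open>M\<close> the set of levels at
  which one word occurs, this separates a single occurrence from the coincidences between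
  levels.\<close>

lemma card_le_one_plus_pairs:
  fixes M :: "nat set"
  assumes "finite M"
  shows "card M \<le> (if M = {} then 0 else 1) + card {(l, l'). l \<in> M \<and> l' \<in> M \<and> l < l'}"
proof (cases "M = {}")
  case False
  define m where "m = Min M"
  have m: "m \<in> M" "\<And>l. l \<in> M \<Longrightarrow> m \<le> l" using False assms by (auto simp: m_def)
  have fin: "finite {(l, l'). l \<in> M \<and> l' \<in> M \<and> l < l'}"
    by (rule finite_subset[of _ "M \<times> M"]) (use assms in auto)
  have "card (M - {m}) = card ((\<lambda>l. (m, l)) ` (M - {m}))" by (simp add: card_image inj_on_def)
  also have "\<dots> \<le> card {(l, l'). l \<in> M \<and> l' \<in> M \<and> l < l'}"
    using fin by (rule card_mono) (use m in force)
  finally show ?thesis using False m(1) assms by (simp add: card_Diff_singleton)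
qed simp

context block_chain
begin

lemma member_mono: "l \<le> l' \<Longrightarrow> member l f \<subseteq> member l' f"
  using C_mono[OF diff_le_mono[of l l' s]] by (auto simp: member_def)

text \<open>Given a set \<open>A\<close> of level \<open>l\<close> in \<open>\<B>\<close>, the sets
  \<open>R\<close> of size \<open>l' - l\<close> outside \<open>A\<close> with
  \<open>A \<union> R\<close> in \<open>\<B>\<close> inherit the forbidden difference, since
  \<open>(A \<union> R) - (A \<union> R') = R - R'\<close>. So \<open>layer_bound\<close> in
  \<open>X - A\<close> gives them density at most \<open>K / q ^ k\<close>. The gap
  \<open>l + s \<le> l'\<close> provides the size at least \<open>s\<close> required there.\<close>

lemma card_permutes_comparable:
  assumes code: "code_const k s K" and q: "1 \<le> q" and f: "f \<in> words s q"
    and l: "s \<le> l" "l + s \<le> l'" "l' - s + s * q \<le> card X" and B: "\<B> \<subseteq> Pow X"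
    and no: "\<And>A B. A \<in> \<B> \<Longrightarrow> B \<in> \<B> \<Longrightarrow> card (A - B) \<noteq> k"
  shows "real (card {\<sigma>. \<sigma> permutes X \<and> \<sigma> ` member l f \<in> \<B> \<and> \<sigma> ` member l' f \<in> \<B>}) \<le>
    fact (card X) * (real (card {A\<in>\<B>. card A = l}) / real (card X choose l)) * (real K / real q ^ k)"
proof -
  define P where "P = member l f"
  define Q where "Q = member l' f - member l f"
  define d where "d = l' - l"
  define n where "n = card X"
  have l0: "l - s + s * q \<le> card X" using l by linarith
  have ll: "l \<le> l'" "s \<le> l'" using l by auto
  have P: "P \<subseteq> X" "card P = l" using member_subset[OF f l0] card_member[OF f l0 l(1)] by (auto simp: P_def)
  have P': "member l' f \<subseteq> X" "card (member l' f) = l'"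
    using member_subset[OF f l(3)] card_member[OF f l(3) ll(2)] by auto
  have PQ: "member l' f = P \<union> Q" using member_mono[OF ll(1)] by (auto simp: P_def Q_def)
  have finP: "finite P" using P(1) finX finite_subset by blast
  have Q: "Q \<subseteq> X - P" "card Q = d"
  proof -
    show "Q \<subseteq> X - P" using P'(1) by (auto simp: Q_def P_def)
    show "card Q = d" unfolding Q_def d_def P_def[symmetric]
      using finP member_mono[OF ll(1), of f] P(2) P'(2) by (simp add: card_Diff_subset P_def)
  qed
  define up where "up A = {R\<in>nsets (X - A) d. A \<union> R \<in> \<B>}" for A
  define \<B>l where "\<B>l = {A\<in>\<B>. card A = l}"
  define \<S> where "\<S> = Sigma \<B>l up"
  have finB: "finite \<B>l" using B finX by (auto simp: \<B>l_def intro: finite_subset)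
  have finup: "finite (up A)" for A using finX by (simp add: up_def finite_imp_finite_nsets)
  have Bl: "A \<subseteq> X" "finite A" "card A = l" if "A \<in> \<B>l" for A
    using that B finite_subset[OF _ finX, of A] by (auto simp: \<B>l_def)
  have \<S>_sub: "\<S> \<subseteq> Sigma (nsets X (card P)) (\<lambda>A. nsets (X - A) (card Q))"
    using Bl by (auto simp: \<S>_def up_def nsets_def P(2) Q(2))
  have binpos: "real ((n - l) choose d) > 0"
  proof -
    have "s \<le> s * q" using q by simp
    then have "l' \<le> card X" using l by linarith
    then have "d \<le> n - l" by (simp add: d_def n_def)
    then show ?thesis by simp
  qed
  have up_bound: "real (card (up A)) \<le> real K / real q ^ k * real ((n - l) choose d)" if A: "A \<in> \<B>l" for A
  proof -
    have "card (X - A) = n - l" using Bl[OF A] by (simp add: card_Diff_subset n_def)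
    moreover have "real (card (up A)) * real q ^ k \<le> real K * real (card (X - A) choose d)"
    proof (rule layer_bound[OF code q])
      show "finite (X - A)" using finX by simp
      show "s \<le> d" using l by (simp add: d_def)
      show "d - s + s * q \<le> card (X - A)" using l \<open>card (X - A) = n - l\<close> by (simp add: d_def n_def)
      show "up A \<subseteq> nsets (X - A) d" by (auto simp: up_def)
      show "card (R - R') \<noteq> k" if "R \<in> up A" "R' \<in> up A" for R R'
      proof -
        have "(A \<union> R) - (A \<union> R') = R - R'" using that by (auto simp: up_def nsets_def)
        then show ?thesis using no[of "A \<union> R" "A \<union> R'"] that by (auto simp: up_def)
      qed
    qed
    moreover have "real q ^ k > 0" using q by simp
    ultimately show ?thesis by (simp add: field_simps)
  qed
  have "card \<S> = (\<Sum>A\<in>\<B>l. card (up A))" unfolding \<S>_def using finB finup by (simp add: card_SigmaI)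
  then have "real (card \<S>) = (\<Sum>A\<in>\<B>l. real (card (up A)))" by simp
  also have "\<dots> \<le> (\<Sum>A\<in>\<B>l. real K / real q ^ k * real ((n - l) choose d))"
    by (intro sum_mono up_bound)
  also have "\<dots> = real (card \<B>l) * (real K / real q ^ k) * real ((n - l) choose d)" by simp
  finally have cS: "real (card \<S>) / real ((n - l) choose d) \<le> real (card \<B>l) * (real K / real q ^ k)"
    using binpos by (simp add: pos_divide_le_eq)
  have "{\<sigma>. \<sigma> permutes X \<and> \<sigma> ` member l f \<in> \<B> \<and> \<sigma> ` member l' f \<in> \<B>} \<subseteq>
     {\<sigma>. \<sigma> permutes X \<and> (\<sigma> ` P, \<sigma> ` Q) \<in> \<S>}"
  proof (rule Collect_mono, intro impI, elim conjE)
    fix \<sigma> assume \<sigma>: "\<sigma> permutes X" "\<sigma> ` member l f \<in> \<B>" "\<sigma> ` member l' f \<in> \<B>"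
    have i: "inj \<sigma>" "\<sigma> ` X = X" using \<sigma>(1) by (auto simp: permutes_inj permutes_image)
    have inj: "inj_on \<sigma> Z" for Z using i(1) by (rule inj_on_subset) simp
    have "\<sigma> ` Q \<inter> \<sigma> ` P = {}" using Q(1) by (simp add: image_Int[OF i(1), symmetric]) blast
    moreover have "\<sigma> ` Q \<subseteq> X" using Q(1) i(2) by blast
    moreover have "finite Q" using Q(1) finX finite_subset by blast
    ultimately have "\<sigma> ` Q \<in> nsets (X - \<sigma> ` P) d"
      using Q(2) inj by (auto simp: nsets_def card_image)
    moreover have "\<sigma> ` P \<in> \<B>l" using \<sigma>(2) P(2) inj by (simp add: \<B>l_def P_def card_image)
    moreover have "\<sigma> ` P \<union> \<sigma> ` Q \<in> \<B>" using \<sigma>(3) by (simp add: PQ image_Un)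
    ultimately show "\<sigma> permutes X \<and> (\<sigma> ` P, \<sigma> ` Q) \<in> \<S>" using \<sigma>(1) by (simp add: \<S>_def up_def)
  qed
  moreover have "finite {\<sigma>. \<sigma> permutes X \<and> (\<sigma> ` P, \<sigma> ` Q) \<in> \<S>}"
    by (rule finite_subset[OF _ finite_permutations[OF finX]]) auto
  ultimately have "real (card {\<sigma>. \<sigma> permutes X \<and> \<sigma> ` member l f \<in> \<B> \<and> \<sigma> ` member l' f \<in> \<B>})
      \<le> real (card {\<sigma>. \<sigma> permutes X \<and> (\<sigma> ` P, \<sigma> ` Q) \<in> \<S>})"
    by (simp add: card_mono)
  also have "\<dots> = fact n * real (card \<S>) / (real (n choose l) * real ((n - l) choose d))"
    using card_permutes_image_pair[OF finX P(1) Q(1) \<S>_sub] by (simp add: P Q n_def)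
  also have "\<dots> = fact n / real (n choose l) * (real (card \<S>) / real ((n - l) choose d))" by simp
  also have "\<dots> \<le> fact n / real (n choose l) * (real (card \<B>l) * (real K / real q ^ k))"
    by (intro mult_left_mono cS) simp
  finally show ?thesis by (simp add: \<B>l_def n_def)
qed

end

text \<open>Over all permutations and words, count the levels at which the permuted member lies in
  \<open>\<B>\<close>. For one permutation this is at most the number of words occurring at all,
  which form a code, plus the number of pairs of levels shared by a word. On average,
  \<open>W \<le> K / q ^ k + W * card L * K / q ^ k\<close>, and by \<open>few\<close> the last term
  is at most \<open>W / 2\<close>.\<close>

lemma sparse_levels_bound:
  assumes code: "code_const k s K" and q: "1 \<le> q" and X: "finite X"
    and L: "finite L" "\<And>l. l \<in> L \<Longrightarrow> s \<le> l" "\<And>l. l \<in> L \<Longrightarrow> l - s + s * q \<le> card X"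
      "\<And>l l'. l \<in> L \<Longrightarrow> l' \<in> L \<Longrightarrow> l < l' \<Longrightarrow> l + s \<le> l'"
    and few: "2 * real (card L) * real K \<le> real q ^ k"
    and B: "\<B> \<subseteq> Pow X" "\<And>A. A \<in> \<B> \<Longrightarrow> card A \<in> L"
    and no: "\<And>A B. A \<in> \<B> \<Longrightarrow> B \<in> \<B> \<Longrightarrow> card (A - B) \<noteq> k"
  shows "(\<Sum>A\<in>\<B>. 1 / real (card X choose card A)) * real q ^ k \<le> 2 * real K"
proof (cases "L = {}")
  case True
  then have "\<B> = {}" using B by auto
  then show ?thesis by simp
next
  case False
  then obtain l0 where "l0 \<in> L" by blast
  then have "s * q \<le> card X" using L(3)[of l0] by linarith
  then obtain v C where "block_chain X s q v C" using ex_block_chain[OF X] by blast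
  then interpret block_chain X s q v C .
  define n where "n = card X"
  define Per where "Per = {\<sigma>. \<sigma> permutes X}"
  have Per: "finite Per" "card Per = fact n"
    using X by (auto simp: Per_def n_def finite_permutations card_permutations)
  \<comment> \<open>The Lubell weight of \<open>\<B>\<close>: for a fixed word, the expected number
    of levels at which its randomly permuted member lies in \<open>\<B>\<close>.\<close>
  define W where "W = (\<Sum>A\<in>\<B>. 1 / real (n choose card A))"
  define \<B>l where "\<B>l l = {A\<in>\<B>. card A = l}" for l
  have finB: "finite \<B>" using B X by (auto intro: finite_subset)
  have W_eq: "W = (\<Sum>l\<in>L. real (card (\<B>l l)) / real (n choose l))"
  proof -
    have "W = (\<Sum>l\<in>L. \<Sum>A\<in>{A\<in>\<B>. card A = l}. 1 / real (n choose card A))"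
      unfolding W_def by (rule sum.group[symmetric]) (use finB L B in auto)
    also have "\<dots> = (\<Sum>l\<in>L. \<Sum>A\<in>\<B>l l. 1 / real (n choose l))"
      by (intro sum.cong) (auto simp: \<B>l_def)
    finally show ?thesis by simp
  qed
  have W0: "0 \<le> W" by (simp add: W_def sum_nonneg)
  define M where "M \<sigma> f = {l\<in>L. \<sigma> ` member l f \<in> \<B>}" for \<sigma> f
  \<comment> \<open>Levels are forgotten here. Two such words may come from different levels, but
    subtracting the higher member from the lower still has their Hamming distance as its
    size.\<close>
  define U where "U \<sigma> = {f\<in>words s q. M \<sigma> f \<noteq> {}}" for \<sigma>
  define L2 where "L2 = {(l, l'). l \<in> L \<and> l' \<in> L \<and> l < l'}"
  define P where "P \<sigma> f = {z\<in>L2. \<sigma> ` member (fst z) f \<in> \<B> \<and> \<sigma> ` member (snd z) f \<in> \<B>}" for \<sigma> f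
  have finL2: "finite L2" by (rule finite_subset[of _ "L \<times> L"]) (use L in \<open>auto simp: L2_def\<close>)
  have U_bound: "card (U \<sigma>) * q ^ k \<le> K * q ^ s" if \<sigma>: "\<sigma> \<in> Per" for \<sigma>
  proof -
    have "card (diff_set s f g) \<noteq> k" if fg: "f \<in> U \<sigma>" "g \<in> U \<sigma>" for f g
    proof -
      obtain l l' where l: "l \<in> L" "\<sigma> ` member l f \<in> \<B>" "l' \<in> L" "\<sigma> ` member l' g \<in> \<B>"
        using fg by (auto simp: U_def M_def)
      have w: "f \<in> words s q" "g \<in> words s q" using fg by (auto simp: U_def)
      have \<sigma>': "\<sigma> permutes X" using \<sigma> by (simp add: Per_def)
      have sym: "diff_set s f g = diff_set s g f" by (auto simp: diff_set_def)
      show ?thesis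
      proof (cases "l \<le> l'")
        case True
        then show ?thesis using card_member_diff[OF \<sigma>' w True L(3)[OF l(3)]] no[OF l(2,4)] by simp
      next
        case False
        then have "l' \<le> l" by simp
        then show ?thesis
          using card_member_diff[OF \<sigma>' w(2,1) \<open>l' \<le> l\<close> L(3)[OF l(1)]] no[OF l(4,2)] sym by simp
      qed
    qed
    moreover have "U \<sigma> \<subseteq> words s q" by (auto simp: U_def)
    ultimately show ?thesis using code unfolding code_const_def by meson
  qed
  have Ucard: "real (card (U \<sigma>)) \<le> real q ^ s * (real K / real q ^ k)" if "\<sigma> \<in> Per" for \<sigma>
  proof -
    have "real (card (U \<sigma>) * q ^ k) \<le> real (K * q ^ s)" using U_bound[OF that] by (simp only: of_nat_le_iff)
    moreover have "real q ^ k > 0" using q by simp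
    ultimately show ?thesis by (simp add: field_simps)
  qed
  have M_le: "(\<Sum>f\<in>words s q. card (M \<sigma> f)) \<le> card (U \<sigma>) + (\<Sum>f\<in>words s q. card (P \<sigma> f))" for \<sigma>
  proof -
    have "(\<Sum>f\<in>words s q. card (M \<sigma> f)) \<le>
        (\<Sum>f\<in>words s q. (if M \<sigma> f = {} then 0 else 1) + card (P \<sigma> f))"
    proof (rule sum_mono)
      fix f
      have "finite (M \<sigma> f)" using L(1) by (simp add: M_def)
      moreover have "{(l, l'). l \<in> M \<sigma> f \<and> l' \<in> M \<sigma> f \<and> l < l'} = P \<sigma> f"
        by (auto simp: M_def P_def L2_def)
      ultimately show "card (M \<sigma> f) \<le> (if M \<sigma> f = {} then 0 else 1) + card (P \<sigma> f)"
        using card_le_one_plus_pairs[of "M \<sigma> f"] by simp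
    qed
    also have "\<dots> = (\<Sum>f\<in>words s q. if M \<sigma> f = {} then 0 else 1) + (\<Sum>f\<in>words s q. card (P \<sigma> f))"
      by (rule sum.distrib)
    also have "(\<Sum>f\<in>words s q. if M \<sigma> f = {} then 0 else 1) = card (U \<sigma>)"
      by (simp add: sum.If_cases finite_words U_def Int_def)
    finally show ?thesis .
  qed
  have total: "real (\<Sum>\<sigma>\<in>Per. \<Sum>f\<in>words s q. card (M \<sigma> f)) = real q ^ s * (fact n * W)"
  proof -
    have "(\<Sum>\<sigma>\<in>Per. \<Sum>f\<in>words s q. card (M \<sigma> f)) = (\<Sum>f\<in>words s q. \<Sum>\<sigma>\<in>Per. card (M \<sigma> f))"
      by (rule sum.swap)
    also have "\<dots> = (\<Sum>f\<in>words s q. \<Sum>l\<in>L. card {\<sigma>\<in>Per. \<sigma> ` member l f \<in> \<B>})"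
      unfolding M_def by (intro sum.cong refl sum_card_swap Per L)
    finally have "real (\<Sum>\<sigma>\<in>Per. \<Sum>f\<in>words s q. card (M \<sigma> f)) =
        (\<Sum>f\<in>words s q. \<Sum>l\<in>L. real (card {\<sigma>\<in>Per. \<sigma> ` member l f \<in> \<B>}))" by simp
    also have "\<dots> = (\<Sum>f\<in>words s q. \<Sum>l\<in>L. fact n * (real (card (\<B>l l)) / real (n choose l)))"
    proof (intro sum.cong refl)
      fix f l assume f: "f \<in> words s q" and l: "l \<in> L"
      have c: "card (member l f) = l" "member l f \<subseteq> X"
        using card_member[OF f L(3)[OF l] L(2)[OF l]] member_subset[OF f L(3)[OF l]] by auto
      have "card (\<sigma> ` member l f) = l" if "\<sigma> \<in> Per" for \<sigma>
        using that c(1) by (metis Per_def card_image inj_on_subset mem_Collect_eq permutes_inj subset_UNIV)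
      then have "{\<sigma>\<in>Per. \<sigma> ` member l f \<in> \<B>} = {\<sigma>. \<sigma> permutes X \<and> \<sigma> ` member l f \<in> \<B>l l}"
        by (auto simp: \<B>l_def Per_def)
      moreover have "\<B>l l \<subseteq> nsets X (card (member l f))"
        using B(1) finite_subset[OF _ X] by (auto simp: \<B>l_def nsets_def c)
      ultimately show "real (card {\<sigma>\<in>Per. \<sigma> ` member l f \<in> \<B>}) =
          fact n * (real (card (\<B>l l)) / real (n choose l))"
        using card_permutes_image[OF X c(2), of "\<B>l l"] by (simp add: c(1) n_def)
    qed
    also have "\<dots> = real q ^ s * (fact n * W)"
      by (simp add: card_words W_eq sum_distrib_left)
    finally show ?thesis .
  qed
  have pairs: "real (\<Sum>\<sigma>\<in>Per. \<Sum>f\<in>words s q. card (P \<sigma> f)) \<le>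
      real q ^ s * (fact n * W * (real (card L) * (real K / real q ^ k)))"
  proof -
    have "(\<Sum>\<sigma>\<in>Per. \<Sum>f\<in>words s q. card (P \<sigma> f)) = (\<Sum>f\<in>words s q. \<Sum>\<sigma>\<in>Per. card (P \<sigma> f))"
      by (rule sum.swap)
    also have "\<dots> = (\<Sum>f\<in>words s q. \<Sum>z\<in>L2. card {\<sigma>\<in>Per. \<sigma> ` member (fst z) f \<in> \<B> \<and> \<sigma> ` member (snd z) f \<in> \<B>})"
      unfolding P_def by (intro sum.cong refl sum_card_swap Per finL2)
    finally have "real (\<Sum>\<sigma>\<in>Per. \<Sum>f\<in>words s q. card (P \<sigma> f)) =
        (\<Sum>f\<in>words s q. \<Sum>z\<in>L2. real (card {\<sigma>\<in>Per. \<sigma> ` member (fst z) f \<in> \<B> \<and> \<sigma> ` member (snd z) f \<in> \<B>}))"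
      by simp
    also have "\<dots> \<le> (\<Sum>f\<in>words s q. \<Sum>z\<in>L2.
        fact n * (real (card (\<B>l (fst z))) / real (n choose (fst z))) * (real K / real q ^ k))"
    proof (intro sum_mono)
      fix f z assume f: "f \<in> words s q" and z: "z \<in> L2"
      then show "real (card {\<sigma>\<in>Per. \<sigma> ` member (fst z) f \<in> \<B> \<and> \<sigma> ` member (snd z) f \<in> \<B>}) \<le>
        fact n * (real (card (\<B>l (fst z))) / real (n choose (fst z))) * (real K / real q ^ k)"
        using card_permutes_comparable[OF code q f, of "fst z" "snd z" \<B>] L(2,3,4) B(1) no
        by (auto simp: L2_def Per_def n_def \<B>l_def)
    qed
    also have "\<dots> = real q ^ s * (\<Sum>z\<in>L2.
        fact n * (real (card (\<B>l (fst z))) / real (n choose (fst z))) * (real K / real q ^ k))"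
      by (simp add: card_words)
    \<comment> \<open>The summand depends on the lower level only, so letting the second level range
      over all of \<open>L\<close> costs just a factor \<open>card L\<close>.\<close>
    also have "\<dots> \<le> real q ^ s * (\<Sum>z\<in>L \<times> L.
        fact n * (real (card (\<B>l (fst z))) / real (n choose (fst z))) * (real K / real q ^ k))"
      by (intro mult_left_mono sum_mono2) (use L(1) in \<open>auto simp: L2_def\<close>)
    also have "(\<Sum>z\<in>L \<times> L.
        fact n * (real (card (\<B>l (fst z))) / real (n choose (fst z))) * (real K / real q ^ k)) =
        (\<Sum>l\<in>L. \<Sum>l'\<in>L. fact n * (real (card (\<B>l l)) / real (n choose l)) * (real K / real q ^ k))"
      unfolding sum.cartesian_product by (intro sum.cong) auto
    also have "\<dots> = (\<Sum>l\<in>L. real (card (\<B>l l)) / real (n choose l)) * (fact n * (real (card L) * (real K / real q ^ k)))"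
      unfolding sum_distrib_right by (intro sum.cong) simp_all
    finally show ?thesis by (simp add: W_eq algebra_simps)
  qed
  have qk: "real q ^ k > 0" "real q ^ s > 0" using q by auto
  have "(\<Sum>\<sigma>\<in>Per. \<Sum>f\<in>words s q. card (M \<sigma> f)) \<le>
      (\<Sum>\<sigma>\<in>Per. card (U \<sigma>) + (\<Sum>f\<in>words s q. card (P \<sigma> f)))"
    by (intro sum_mono M_le)
  then have "real (\<Sum>\<sigma>\<in>Per. \<Sum>f\<in>words s q. card (M \<sigma> f)) \<le>
      real (\<Sum>\<sigma>\<in>Per. card (U \<sigma>) + (\<Sum>f\<in>words s q. card (P \<sigma> f)))"
    by (simp only: of_nat_le_iff)
  also have "\<dots> = (\<Sum>\<sigma>\<in>Per. real (card (U \<sigma>))) + real (\<Sum>\<sigma>\<in>Per. \<Sum>f\<in>words s q. card (P \<sigma> f))"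
    by (simp add: sum.distrib)
  also have "(\<Sum>\<sigma>\<in>Per. real (card (U \<sigma>))) \<le> (\<Sum>\<sigma>\<in>Per. real q ^ s * (real K / real q ^ k))"
    by (intro sum_mono Ucard)
  also have "\<dots> = fact n * (real q ^ s * (real K / real q ^ k))" by (simp add: Per)
  finally have "real q ^ s * (fact n * W) \<le> fact n * (real q ^ s * (real K / real q ^ k))
      + real q ^ s * (fact n * W * (real (card L) * (real K / real q ^ k)))"
    using total pairs by linarith
  then have "(real q ^ s * fact n) * W \<le>
      (real q ^ s * fact n) * (real K / real q ^ k + W * (real (card L) * (real K / real q ^ k)))"
    by (simp add: algebra_simps)
  then have "W \<le> real K / real q ^ k + W * (real (card L) * (real K / real q ^ k))"
    using qk by (subst (asm) mult_le_cancel_left_pos) auto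
  moreover have "real (card L) * (real K / real q ^ k) \<le> 1 / 2"
    using few qk by (simp add: field_simps)
  then have "W * (real (card L) * (real K / real q ^ k)) \<le> W * (1 / 2)"
    using W0 by (rule mult_left_mono)
  ultimately have "W \<le> 2 * (real K / real q ^ k)" by linarith
  then show ?thesis using qk unfolding W_def n_def by (simp add: field_simps)
qed

section \<open>Set families\<close>

lemma card_residue_class:
  assumes "M > 0"
  shows "card {l::nat. l \<le> N \<and> l mod M = r} \<le> N div M + 1"
proof -
  have "inj_on (\<lambda>l. l div M) {l. l \<le> N \<and> l mod M = r}"
    by (auto simp: inj_on_def) (metis div_mult_mod_eq)
  moreover have "(\<lambda>l. l div M) ` {l. l \<le> N \<and> l mod M = r} \<subseteq> {..N div M}"
    by (auto simp: div_le_mono)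
  ultimately have "card {l. l \<le> N \<and> l mod M = r} \<le> card {..N div M}"
    by (rule card_inj_on_le) simp
  then show ?thesis by simp
qed

text \<open>Sets with fewer than \<open>s\<close> points cannot contain a transversal and are
  counted crudely: there are at most \<open>s * n ^ s\<close>. Now \<open>n ^ (s + k)\<close> is at
  most a constant times \<open>n choose (s + k)\<close>, hence at most that constant times the
  central binomial coefficient.\<close>

lemma small_sets_bound:
  assumes X: "finite X" "card X = n" and n: "1 \<le> n" "s + k \<le> n" and s: "1 \<le> s"
    and B: "\<B> \<subseteq> Pow X" "\<And>A. A \<in> \<B> \<Longrightarrow> card A < s"
  shows "real (card \<B>) * real n ^ k \<le> real (s * (s + k) ^ (s + k)) * real (n choose (n div 2))"
proof -
  have "\<B> \<subseteq> (\<Union>l<s. nsets X l)"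
    using B finite_subset[OF _ X(1)] by (auto simp: nsets_def)
  then have "card \<B> \<le> card (\<Union>l<s. nsets X l)"
    using X by (intro card_mono) (auto simp: finite_imp_finite_nsets)
  also have "\<dots> \<le> (\<Sum>l<s. card (nsets X l))" by (rule card_UN_le) simp
  also have "\<dots> \<le> (\<Sum>l<s. n ^ s)"
  proof (rule sum_mono)
    fix l assume l: "l \<in> {..<s}"
    have "card (nsets X l) \<le> n ^ l" using X n l by (simp add: binomial_le_pow)
    also have "\<dots> \<le> n ^ s" using l n by (intro power_increasing) auto
    finally show "card (nsets X l) \<le> n ^ s" .
  qed
  finally have "real (card \<B>) \<le> real (s * n ^ s)" by (simp only: of_nat_le_iff) simp
  then have "real (card \<B>) * real n ^ k \<le> real (s * n ^ s) * real n ^ k"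
    by (intro mult_right_mono) auto
  also have "\<dots> = real s * real n ^ (s + k)" by (simp add: power_add)
  also have "real n ^ (s + k) = real ((s + k) ^ (s + k)) * (real n / real (s + k)) ^ (s + k)"
    using s by (simp add: power_divide)
  also have "\<dots> \<le> real ((s + k) ^ (s + k)) * real (n choose (n div 2))"
  proof (rule mult_left_mono)
    have "(real n / real (s + k)) ^ (s + k) \<le> real (n choose (s + k))"
      using binomial_ge_n_over_k_pow_k[of "s + k" n, where 'a = real] n by simp
    also have "\<dots> \<le> real (n choose (n div 2))" by (simp add: binomial_maximum)
    finally show "(real n / real (s + k)) ^ (s + k) \<le> real (n choose (n div 2))" .
  qed simp
  finally show ?thesis using s by (simp add: mult.assoc mult_left_mono)
qed

text \<open>Sets below level \<open>s\<close> give the first summand of the constant. The other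
  levels split into \<open>8 * s * K\<close> residue classes, each handled by
  \<open>sparse_levels_bound\<close>; the factor \<open>(4 * s) ^ k\<close> turns
  \<open>q ^ k\<close> into \<open>n ^ k\<close>.\<close>

lemma lower_half_bound:
  assumes code: "code_const k s K" and k: "1 \<le> k" and s: "1 \<le> s" and K: "1 \<le> K"
    and n: "16 * s * K + s + k \<le> n" and X: "finite X" "card X = n"
    and B: "\<B> \<subseteq> Pow X" "\<And>A. A \<in> \<B> \<Longrightarrow> card A \<le> n div 2"
    and no: "\<And>A B. A \<in> \<B> \<Longrightarrow> B \<in> \<B> \<Longrightarrow> card (A - B) \<noteq> k"
  shows "real (card \<B>) * real n ^ k \<le>
    real (s * (s + k) ^ (s + k) + 8 * s * K * (2 * K) * (4 * s) ^ k) * real (n choose (n div 2))"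
proof -
  \<comment> \<open>Levels congruent modulo \<open>M\<close> are at least \<open>s\<close> apart and number at most \<open>q / (2 * K)\<close>.\<close>
  define M where "M = 8 * s * K"
  \<comment> \<open>The blocks fill at most half of \<open>X\<close>, which leaves room for the
    chain up to level \<open>n div 2\<close>, while \<open>q\<close> stays linear in
    \<open>n\<close>.\<close>
  define q where "q = n div (2 * s)"
  define b where "b = real (n choose (n div 2))"
  define L where "L r = {l. s \<le> l \<and> l \<le> n div 2 \<and> l mod M = r}" for r
  define \<B>r where "\<B>r r = {A\<in>\<B>. card A \<in> L r}" for r
  have M: "M > 0" "s \<le> M" using s K by (auto simp: M_def)
  have n2: "2 * M \<le> n" using n by (simp add: M_def)
  have finB: "finite \<B>" using B X by (auto intro: finite_subset)
  have sq: "s * q \<le> n div 2"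
  proof -
    have "2 * s * q \<le> n" unfolding q_def by simp
    then show ?thesis by linarith
  qed
  have qge: "real n \<le> 4 * real s * real q"
  proof -
    have "2 * s \<le> 2 * M" using M by simp
    then have "2 * s \<le> n" using n2 by linarith
    then have q1: "1 \<le> q" using s by (simp add: q_def Suc_le_eq div_greater_zero_iff)
    have "n = 2 * s * q + n mod (2 * s)" by (simp add: q_def)
    moreover have "n mod (2 * s) < 2 * s" using s by simp
    moreover have "2 * s \<le> 2 * s * q" using q1 by simp
    ultimately have "n \<le> 4 * s * q" by linarith
    then have "real n \<le> real (4 * s * q)" by (simp only: of_nat_le_iff)
    then show ?thesis by simp
  qed
  have npos: "real n > 0" using n s by simp
  have q1: "1 \<le> q"
  proof (rule ccontr)
    assume "\<not> 1 \<le> q"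
    then have "q = 0" by simp
    then show False using qge npos by simp
  qed
  \<comment> \<open>A class has at most \<open>n / (2 * M) + 1 \<le> n / M\<close> levels, as
    \<open>2 * M \<le> n\<close>. With \<open>M = 8 * s * K\<close> the left side is at most
    \<open>n / (4 * s) \<le> q\<close>, and \<open>q \<le> q ^ k\<close> because
    \<open>k \<ge> 1\<close>.\<close>
  have few: "2 * real (card (L r)) * real K \<le> real q ^ k" for r
  proof -
    have "card (L r) \<le> card {l. l \<le> n div 2 \<and> l mod M = r}"
      by (intro card_mono) (auto simp: L_def)
    also have "\<dots> \<le> n div 2 div M + 1" by (rule card_residue_class[OF M(1)])
    finally have "real (card (L r)) \<le> real (n div 2 div M) + 1" by linarith
    also have "real (n div 2 div M) = real (n div (2 * M))" by (simp add: div_mult2_eq)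
    also have "\<dots> \<le> real n / real (2 * M)" by (rule of_nat_div_le_of_nat)
    finally have "real (card (L r)) \<le> real n / real (2 * M) + 1" by simp
    moreover have "1 \<le> real n / real (2 * M)" using n2 M(1) by (simp add: pos_le_divide_eq)
    ultimately have "real (card (L r)) \<le> real n / real M" by simp
    then have "2 * real (card (L r)) * real K \<le> 2 * (real n / real M) * real K"
      by (intro mult_right_mono mult_left_mono) auto
    also have "\<dots> = real n / (4 * real s)" using K s by (simp add: M_def field_simps)
    also have "\<dots> \<le> real q" using qge s by (simp add: field_simps)
    also have "\<dots> \<le> real q ^ k" using q1 k by (intro self_le_power) auto
    finally show ?thesis .
  qed
  have bpos: "b > 0" by (simp add: b_def zero_less_binomial_iff)
  have res: "real (card (\<B>r r)) * real n ^ k \<le> real (2 * K * (4 * s) ^ k) * b" for r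
  proof -
    have "(\<Sum>A\<in>\<B>r r. 1 / real (card X choose card A)) * real q ^ k \<le> 2 * real K"
    proof (rule sparse_levels_bound[OF code q1 X(1), of "L r"])
      show "finite (L r)" by (simp add: L_def)
      show "l - s + s * q \<le> card X" if "l \<in> L r" for l
      proof -
        have "l \<le> n div 2" using that by (simp add: L_def)
        then show ?thesis using sq X by linarith
      qed
      show "l + s \<le> l'" if "l \<in> L r" "l' \<in> L r" "l < l'" for l l'
      proof -
        have "l mod M = l' mod M" using that by (simp add: L_def)
        then have "M dvd l' - l" using that(3) by (metis mod_eq_dvd_iff_nat less_imp_le)
        then have "M \<le> l' - l" using that(3) by (intro dvd_imp_le) auto
        then show ?thesis using M(2) that(3) by linarith
      qed
    qed (use B no few in \<open>auto simp: \<B>r_def L_def\<close>)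
    \<comment> \<open>Every binomial coefficient is at most the central one, so the Lubell weight
      bounds the cardinality divided by \<open>b\<close>.\<close>
    moreover have "(\<Sum>A\<in>\<B>r r. 1 / b) \<le> (\<Sum>A\<in>\<B>r r. 1 / real (card X choose card A))"
    proof (rule sum_mono)
      fix A assume "A \<in> \<B>r r"
      then have "A \<subseteq> X" using B by (auto simp: \<B>r_def)
      then have "card A \<le> n" using X card_mono by blast
      then show "1 / b \<le> 1 / real (card X choose card A)"
        using binomial_maximum[of n "card A"] X unfolding b_def
        by (intro divide_left_mono) (auto simp: zero_less_binomial_iff)
    qed
    then have "(\<Sum>A\<in>\<B>r r. 1 / b) * real q ^ k \<le>
        (\<Sum>A\<in>\<B>r r. 1 / real (card X choose card A)) * real q ^ k"
      by (rule mult_right_mono) simp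
    ultimately have "(real (card (\<B>r r)) / b) * real q ^ k \<le> 2 * real K" by simp
    then have 1: "real (card (\<B>r r)) * real q ^ k \<le> 2 * real K * b"
      using bpos by (simp add: field_simps)
    have "real n ^ k \<le> (4 * real s * real q) ^ k" using qge by (intro power_mono) auto
    then have "real (card (\<B>r r)) * real n ^ k \<le> real (card (\<B>r r)) * (4 * real s * real q) ^ k"
      by (intro mult_left_mono) auto
    also have "\<dots> = (real (card (\<B>r r)) * real q ^ k) * (4 * real s) ^ k"
      by (simp add: power_mult_distrib)
    also have "\<dots> \<le> (2 * real K * b) * (4 * real s) ^ k" using 1 by (intro mult_right_mono) auto
    finally show ?thesis by (simp add: algebra_simps)
  qed
  define \<B>0 where "\<B>0 = {A\<in>\<B>. card A < s}"
  have small: "real (card \<B>0) * real n ^ k \<le> real (s * (s + k) ^ (s + k)) * b"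
    unfolding b_def by (rule small_sets_bound[OF X]) (use n s B in \<open>auto simp: \<B>0_def\<close>)
  have "\<B> \<subseteq> \<B>0 \<union> (\<Union>r<M. \<B>r r)"
  proof
    fix A assume A: "A \<in> \<B>"
    show "A \<in> \<B>0 \<union> (\<Union>r<M. \<B>r r)"
    proof (cases "card A < s")
      case False
      then have "A \<in> \<B>r (card A mod M)" using A B(2)[OF A] by (auto simp: \<B>r_def L_def)
      moreover have "card A mod M < M" using M by simp
      ultimately show ?thesis by blast
    qed (use A in \<open>simp add: \<B>0_def\<close>)
  qed
  then have "card \<B> \<le> card (\<B>0 \<union> (\<Union>r<M. \<B>r r))"
    using finB by (intro card_mono) (auto simp: \<B>0_def \<B>r_def)
  also have "\<dots> \<le> card \<B>0 + card (\<Union>r<M. \<B>r r)" by (rule card_Un_le)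
  also have "card (\<Union>r<M. \<B>r r) \<le> (\<Sum>r<M. card (\<B>r r))" by (rule card_UN_le) simp
  finally have "card \<B> \<le> card \<B>0 + (\<Sum>r<M. card (\<B>r r))" by simp
  then have "real (card \<B>) \<le> real (card \<B>0 + (\<Sum>r<M. card (\<B>r r)))" by (simp only: of_nat_le_iff)
  then have "real (card \<B>) * real n ^ k \<le> (real (card \<B>0) + (\<Sum>r<M. real (card (\<B>r r)))) * real n ^ k"
    by (intro mult_right_mono) auto
  also have "\<dots> = real (card \<B>0) * real n ^ k + (\<Sum>r<M. real (card (\<B>r r)) * real n ^ k)"
    by (simp add: distrib_right sum_distrib_right)
  also have "\<dots> \<le> real (s * (s + k) ^ (s + k)) * b + (\<Sum>r<M. real (2 * K * (4 * s) ^ k) * b)"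
    by (intro add_mono small sum_mono res)
  also have "\<dots> = real (s * (s + k) ^ (s + k) + M * (2 * K) * (4 * s) ^ k) * b"
    by (simp add: algebra_simps)
  finally show ?thesis by (simp add: M_def b_def)
qed

section \<open>Complementation and small ground sets\<close>

theorem theorem3:
  fixes k :: nat
  shows "\<exists>C::real. C > 0 \<and>
    (\<forall>n::nat. n \<ge> 1 \<longrightarrow>
      (\<forall>\<A> :: nat set set. \<A> \<subseteq> Pow {1..n} \<longrightarrow>
        (\<forall>A\<in>\<A>. \<forall>B\<in>\<A>. card (A - B) \<noteq> k) \<longrightarrow>
        real (card \<A>) \<le> C / real n ^ k * real (n choose (n div 2))))"
proof (cases "k = 0")
  case True
  \<comment> \<open>For \<open>k = 0\<close> the choice \<open>B = A\<close> violates the condition,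
    so only the empty family remains.\<close>
  have "\<A> = {}" if "\<forall>A\<in>\<A>. \<forall>B\<in>\<A>. card (A - B) \<noteq> k" for \<A> :: "nat set set"
    using that True by force
  then show ?thesis by (intro exI[of _ 1]) fastforce
next
  case False
  then have k: "1 \<le> k" by simp
  obtain s K :: nat where sK: "k \<le> s" "1 \<le> K" and bound:
    "\<And>q F. F \<subseteq> words s q \<Longrightarrow> (\<And>f g. f \<in> F \<Longrightarrow> g \<in> F \<Longrightarrow> card (diff_set s f g) \<noteq> k) \<Longrightarrow>
       card F * q ^ k \<le> K * q ^ s"
    using code_bound[OF k] by metis
  have code: "code_const k s K" unfolding code_const_def using bound by simp
  have s: "1 \<le> s" using k sK by simp
  define N where "N = 16 * s * K + s + k"
  define H where "H = s * (s + k) ^ (s + k) + 8 * s * K * (2 * K) * (4 * s) ^ k"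
  \<comment> \<open>One \<open>H\<close> for each half of the power set when
    \<open>n \<ge> N\<close>; the second summand covers \<open>n < N\<close> through the trivial
    bound \<open>2 ^ n\<close>.\<close>
  define C where "C = 2 * real H + 2 ^ N * real N ^ k"
  have "N > 0" using s by (simp add: N_def)
  then have Cpos: "C > 0" unfolding C_def by (intro add_nonneg_pos) auto
  have main: "real (card \<A>) * real n ^ k \<le> C * real (n choose (n div 2))"
    if n: "n \<ge> 1" and A: "\<A> \<subseteq> Pow {1..n}" and no: "\<forall>A\<in>\<A>. \<forall>B\<in>\<A>. card (A - B) \<noteq> k"
    for n and \<A> :: "nat set set"
  proof -
    define b where "b = real (n choose (n div 2))"
    have "n choose (n div 2) \<ge> 1" by (simp add: Suc_le_eq zero_less_binomial_iff)
    then have b1: "b \<ge> 1" unfolding b_def by linarith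
    have finA: "finite \<A>" using A by (rule finite_subset) simp
    show ?thesis
    proof (cases "N \<le> n")
      case True
      define lo where "lo = {A\<in>\<A>. card A \<le> n div 2}"
      define hi where "hi = {A\<in>\<A>. card A > n div 2}"
      \<comment> \<open>Complementation reverses differences:
        \<open>({1..n} - A) - ({1..n} - B) = B - A\<close>. As the condition holds for both orders
        of a pair, it passes to \<open>co\<close>, whose members have size at most
        \<open>n div 2\<close>.\<close>
      define co where "co = (\<lambda>A. {1..n} - A) ` hi"
      have half: "real (card \<B>) * real n ^ k \<le> real H * b"
        if "\<B> \<subseteq> Pow {1..n}" "\<And>A. A \<in> \<B> \<Longrightarrow> card A \<le> n div 2"
           "\<And>A B. A \<in> \<B> \<Longrightarrow> B \<in> \<B> \<Longrightarrow> card (A - B) \<noteq> k" for \<B>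
        unfolding H_def b_def
        by (rule lower_half_bound[OF code k s sK(2) _ _ _ that]) (use True in \<open>auto simp: N_def\<close>)
      have "real (card lo) * real n ^ k \<le> real H * b"
        by (rule half) (use A no in \<open>auto simp: lo_def\<close>)
      moreover have "real (card co) * real n ^ k \<le> real H * b"
      proof (rule half)
        show "co \<subseteq> Pow {1..n}" by (auto simp: co_def)
        show "card D \<le> n div 2" if "D \<in> co" for D
        proof -
          obtain A' where A': "A' \<in> \<A>" "card A' > n div 2" "D = {1..n} - A'"
            using \<open>D \<in> co\<close> by (auto simp: co_def hi_def)
          have "A' \<subseteq> {1..n}" using A' A by blast
          then have "card D = n - card A'" using A'(3) finite_subset[of A' "{1..n}"]
            by (simp add: card_Diff_subset)
          then show ?thesis using A'(2) by linarith
        qed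
        show "card (D - E) \<noteq> k" if "D \<in> co" "E \<in> co" for D E
        proof -
          obtain A' B' where AB: "A' \<in> \<A>" "D = {1..n} - A'" "B' \<in> \<A>" "E = {1..n} - B'"
            using \<open>D \<in> co\<close> \<open>E \<in> co\<close> by (auto simp: co_def hi_def)
          have "B' \<subseteq> {1..n}" using AB A by blast
          then have "D - E = B' - A'" using AB by auto
          then show ?thesis using no AB by simp
        qed
      qed
      moreover have "card co = card hi" unfolding co_def
      proof (rule card_image, rule inj_onI)
        fix A' B' assume "A' \<in> hi" "B' \<in> hi" "{1..n} - A' = {1..n} - B'"
        moreover have "A' \<subseteq> {1..n}" "B' \<subseteq> {1..n}" using calculation A by (auto simp: hi_def)
        ultimately show "A' = B'" by blast
      qed
      moreover have "card \<A> = card lo + card hi"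
      proof -
        have "\<A> = lo \<union> hi" "lo \<inter> hi = {}" by (auto simp: lo_def hi_def)
        moreover have "finite lo" "finite hi" using finA by (auto simp: lo_def hi_def)
        ultimately show ?thesis by (simp add: card_Un_disjoint)
      qed
      ultimately have "real (card \<A>) * real n ^ k \<le> 2 * real H * b" by (simp add: algebra_simps)
      also have "\<dots> \<le> C * b" using b1 by (intro mult_right_mono) (auto simp: C_def)
      finally show ?thesis by (simp add: b_def)
    next
      case False
      have "card \<A> \<le> card (Pow {1..n})" using A by (intro card_mono) auto
      also have "\<dots> \<le> 2 ^ N" using False by (simp add: card_Pow)
      finally have "real (card \<A>) \<le> real (2 ^ N)" by (simp only: of_nat_le_iff)
      then have "real (card \<A>) * real n ^ k \<le> 2 ^ N * real N ^ k"
        using False by (intro mult_mono power_mono) auto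
      also have "\<dots> \<le> C" by (simp add: C_def)
      also have "\<dots> \<le> C * b" using b1 Cpos by simp
      finally show ?thesis by (simp add: b_def)
    qed
  qed
  show ?thesis
  proof (intro exI[of _ C] conjI allI impI Cpos)
    fix n :: nat and \<A> :: "nat set set"
    assume h: "n \<ge> 1" "\<A> \<subseteq> Pow {1..n}" "\<forall>A\<in>\<A>. \<forall>B\<in>\<A>. card (A - B) \<noteq> k"
    then have "real n ^ k > 0" by simp
    then show "real (card \<A>) \<le> C / real n ^ k * real (n choose (n div 2))"
      using main[OF h] by (simp add: field_simps)
  qed
qed

end
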